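(* Consider an $\mathcal{FS}$-space with metric function $F=bV(x,w)$ ($b>0$), scalars $C(x),C_1(x)$ with $C>0$, $C>|C_1|$, and $H=\sqrt{C^2-C_1^2}$. Let $\varrho=\varrho(x,w)$ and let $\mu$, where $\sqrt\mu=C+C_1\cos\varrho$, be such that $$\mu=\frac{\tau}{\widetilde w^2}\sin^2\varrho ,$$ and let $\varrho$ satisfy the equation $$\frac{\partial\varrho}{\partial\widetilde w}=\frac1{\widetilde w}\sqrt{\frac{\widetilde\tau-\widetilde w(\widetilde\tau'-\widetilde w)}{\widetilde\tau}}\;\sin\varrho .$$ Then the transformation $t^m=t^m(x,y)$ given by $$t^m=\left[i^m\sin\varrho+\frac1{2\breve k}\left(1-\breve k^2+(1+\breve k^2)\cos\varrho\right)\widetilde b^m\right]\frac{H}{\sqrt\mu}F^H$$ realizes a conformal automorphism of degree $H$ of $(M,F)$ to $(M,S)$.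
   Context: $(M,S)$ is a Riemannian space of dimension $N\ge3$, $S(x,y)=\sqrt{a_{ij}(x)y^iy^j}$, and $b=b_i(x)y^i$ is a non-vanishing 1-form whose Riemannian norm $c=c(x)=\sqrt{a^{ij}b_ib_j}$ satisfies $0<c<1$. Put $b^i=a^{ij}b_j$, $\widetilde b_i=b_i/c$, $\widetilde b^i=b^i/c$, $$q=\sqrt{a_{ij}y^iy^j-b^2},\quad w=\frac qb,\quad \widetilde q=\sqrt{q^2+\left(1-\tfrac1{c^2}\right)b^2},\quad \widetilde w=\frac{\widetilde q}{b},\quad i^m=\left(y^m-\tfrac1{c^2}b\,b^m\right)\frac1{\widetilde q}.$$ Everything is considered locally, in the domain $b>0$, $\widetilde q>0$. An $\mathcal{FS}$-space has a Finsler metric function $F$ depending on $x$, $b$ and $S$ only, written as $F=bV(x,w)$ (equivalently $F=b\widetilde V(x,\widetilde w)$). With $V'=\partial V/\partial w$, $\tau=wV/V'$; the same quantity as a function of $(x,\widetilde w)$ is $\widetilde\tau=\widetilde w\widetilde V/(\partial\widetilde V/\partial\widetilde w)$, and $\widetilde\tau'=\partial\widetilde\tau/\partial\widetilde w$. Also $$\breve k=\sqrt{\frac{C-C_1}{C+C_1}},\qquad \sqrt\mu=\frac{H}{2\breve k}\left[1+\breve k^2+(1-\breve k^2)\cos\varrho\right]=C+C_1\cos\varrho .$$ A Finsler metric function is smooth, positive, positively 1-homogeneous in $y$, with positive-definite $g_{ij}=\frac12\,\partial^2F^2/\partial y^i\partial y^j$. A transformation $t=t(x,y)$ (locally invertible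 in $y$, $x$ fixed) realizes a conformal automorphism of degree $H$ of $(M,F)$ to $(M,S)$ if $t^m(x,ky)=k^Ht^m(x,y)$ for $k>0$; $F(x,y)=1\iff S(x,t(x,y))=1$; and $g_{mn}(x,y)=p^2a_{ij}(x)t^i_mt^j_n$ with $t^i_m=\partial t^i/\partial y^m$, $p=\frac1HF^{1-H}$. *)

theory Defs
  imports "HOL-Analysis.Analysis"
begin

text \<open>
  Everything is written in one coordinate chart: base points \<^term>\<open>x\<close> range over an open set
  \<open>U\<close> of \<open>real^'n\<close>, tangent vectors \<open>y\<close> over \<open>real^'n\<close>, and a point of the tangent bundle is a
  pair \<open>(x, y)\<close>. The metric tensor is a matrix-valued map \<open>a\<close>, the 1-form is given by its
  covariant components \<open>b x\<close>.
\<close>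

subsection \<open>Smoothness\<close>

text \<open>Intended for open sets \<open>D\<close> only.\<close>

fun Ck_on :: "nat \<Rightarrow> ('a::euclidean_space \<Rightarrow> 'b::real_normed_vector) \<Rightarrow> 'a set \<Rightarrow> bool" where
  "Ck_on 0 f D \<longleftrightarrow> continuous_on D f"
| "Ck_on (Suc k) f D \<longleftrightarrow>
     (\<forall>z\<in>D. f differentiable (at z)) \<and>
     (\<forall>e\<in>Basis. Ck_on k (\<lambda>z. frechet_derivative f (at z) e) D)"

definition smooth_on :: "('a::euclidean_space \<Rightarrow> 'b::real_normed_vector) \<Rightarrow> 'a set \<Rightarrow> bool" where
  "smooth_on f D \<longleftrightarrow> (\<forall>k. Ck_on k f D)"

subsection \<open>The Riemannian metric and the 1-form\<close>

definition riemannian_metric_on :: "(real^'n) set \<Rightarrow> (real^'n \<Rightarrow> real^'n^'n) \<Rightarrow> bool" where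
  "riemannian_metric_on U a \<longleftrightarrow>
     smooth_on a U \<and>
     (\<forall>x\<in>U. transpose (a x) = a x \<and> (\<forall>v. v \<noteq> 0 \<longrightarrow> 0 < v \<bullet> (a x *v v)))"

definition riem_norm :: "(real^'n \<Rightarrow> real^'n^'n) \<Rightarrow> real^'n \<Rightarrow> real^'n \<Rightarrow> real" where
  "riem_norm a x y = sqrt (y \<bullet> (a x *v y))"

text \<open>The value \<open>b = b_i(x) y^i\<close> of the 1-form, and the vector \<open>b^i = a^{ij} b_j\<close>.\<close>

definition form_val :: "(real^'n \<Rightarrow> real^'n) \<Rightarrow> real^'n \<Rightarrow> real^'n \<Rightarrow> real" where
  "form_val b x y = b x \<bullet> y"

definition b_up :: "(real^'n \<Rightarrow> real^'n^'n) \<Rightarrow> (real^'n \<Rightarrow> real^'n) \<Rightarrow> real^'n \<Rightarrow> real^'n" where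
  "b_up a b x = matrix_inv (a x) *v b x"

definition form_norm :: "(real^'n \<Rightarrow> real^'n^'n) \<Rightarrow> (real^'n \<Rightarrow> real^'n) \<Rightarrow> real^'n \<Rightarrow> real" where
  "form_norm a b x = sqrt (b x \<bullet> (matrix_inv (a x) *v b x))"

definition b_unit :: "(real^'n \<Rightarrow> real^'n^'n) \<Rightarrow> (real^'n \<Rightarrow> real^'n) \<Rightarrow> real^'n \<Rightarrow> real^'n" where
  "b_unit a b x = (1 / form_norm a b x) *\<^sub>R b_up a b x"

subsection \<open>The scalars \<open>q\<close>, \<open>w\<close> and their counterparts with tilde (suffix \<open>t\<close>)\<close>

definition q_var :: "(real^'n \<Rightarrow> real^'n^'n) \<Rightarrow> (real^'n \<Rightarrow> real^'n) \<Rightarrow> real^'n \<Rightarrow> real^'n \<Rightarrow> real" where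
  "q_var a b x y = sqrt (y \<bullet> (a x *v y) - (form_val b x y)\<^sup>2)"

definition w_var :: "(real^'n \<Rightarrow> real^'n^'n) \<Rightarrow> (real^'n \<Rightarrow> real^'n) \<Rightarrow> real^'n \<Rightarrow> real^'n \<Rightarrow> real" where
  "w_var a b x y = q_var a b x y / form_val b x y"

definition qt_var :: "(real^'n \<Rightarrow> real^'n^'n) \<Rightarrow> (real^'n \<Rightarrow> real^'n) \<Rightarrow> real^'n \<Rightarrow> real^'n \<Rightarrow> real" where
  "qt_var a b x y =
     sqrt ((q_var a b x y)\<^sup>2 + (1 - 1 / (form_norm a b x)\<^sup>2) * (form_val b x y)\<^sup>2)"

definition wt_var :: "(real^'n \<Rightarrow> real^'n^'n) \<Rightarrow> (real^'n \<Rightarrow> real^'n) \<Rightarrow> real^'n \<Rightarrow> real^'n \<Rightarrow> real" where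
  "wt_var a b x y = qt_var a b x y / form_val b x y"

definition i_vec :: "(real^'n \<Rightarrow> real^'n^'n) \<Rightarrow> (real^'n \<Rightarrow> real^'n) \<Rightarrow> real^'n \<Rightarrow> real^'n \<Rightarrow> real^'n" where
  "i_vec a b x y =
     (1 / qt_var a b x y) *\<^sub>R (y - (1 / (form_norm a b x)\<^sup>2 * form_val b x y) *\<^sub>R b_up a b x)"

text \<open>
  At fixed \<open>x\<close> the two scalars determine each other: \<open>wt^2 = w^2 + 1 - 1/c^2\<close>, so a function \<open>f(x,w)\<close>
  becomes the function \<open>f(x, sqrt (wt^2 - 1 + 1/c^2))\<close> of \<open>(x,wt)\<close>. The argument \<open>c\<close> below is the
  norm of the 1-form as a function of \<open>x\<close>.
\<close>

definition in_wt :: "(real^'n \<Rightarrow> real) \<Rightarrow> (real^'n \<Rightarrow> real \<Rightarrow> real) \<Rightarrow> real^'n \<Rightarrow> real \<Rightarrow> real" where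
  "in_wt c f x s = f x (sqrt (s\<^sup>2 - 1 + 1 / (c x)\<^sup>2))"

text \<open>
  \<open>w V / V'\<close> with the derivative in the second argument; applied to \<open>V\<close> it gives \<open>\<tau>(x,w)\<close>, applied
  to \<open>V\<close> rewritten in \<open>(x,wt)\<close> it gives \<open>\<tau>\<close> with tilde.
\<close>

definition tau_of :: "(real^'n \<Rightarrow> real \<Rightarrow> real) \<Rightarrow> real^'n \<Rightarrow> real \<Rightarrow> real" where
  "tau_of V x s = s * V x s / deriv (V x) s"

subsection \<open>Finsler metric functions and conformal automorphisms\<close>

definition conic_domain_over :: "(real^'n) set \<Rightarrow> ((real^'n) \<times> (real^'n)) set \<Rightarrow> bool" where
  "conic_domain_over U D \<longleftrightarrow>
     open D \<and> D \<subseteq> U \<times> UNIV \<and> (\<forall>x y k. (x, y) \<in> D \<longrightarrow> 0 < k \<longrightarrow> (x, k *\<^sub>R y) \<in> D)"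

definition partial :: "'n \<Rightarrow> (real^'n \<Rightarrow> real) \<Rightarrow> real^'n \<Rightarrow> real" where
  "partial i f y = frechet_derivative f (at y) (axis i 1)"

definition finsler_tensor :: "(real^'n \<Rightarrow> real^'n \<Rightarrow> real) \<Rightarrow> real^'n \<Rightarrow> real^'n \<Rightarrow> real^'n^'n" where
  "finsler_tensor F x y = (\<chi> i j. 1 / 2 * partial i (partial j (\<lambda>z. (F x z)\<^sup>2)) y)"

definition finsler_metric_on ::
    "((real^'n) \<times> (real^'n)) set \<Rightarrow> (real^'n \<Rightarrow> real^'n \<Rightarrow> real) \<Rightarrow> bool" where
  "finsler_metric_on D F \<longleftrightarrow>
     smooth_on (\<lambda>(x, y). F x y) D \<and>
     (\<forall>(x, y)\<in>D. 0 < F x y \<and>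
        (\<forall>k>0. F x (k *\<^sub>R y) = k * F x y) \<and>
        (\<forall>v. v \<noteq> 0 \<longrightarrow> 0 < v \<bullet> (finsler_tensor F x y *v v)))"

text \<open>
  The transformation acts in the tangent spaces, with \<open>x\<close> fixed. It is required to be of class
  \<open>C^1\<close> in \<open>y\<close>, so that the \<open>t^i_m\<close> (entries of the Jacobian matrix) make sense, and to restrict,
  near each \<open>y\<close>, to a homeomorphism between open sets.
\<close>

definition conformal_automorphism ::
    "((real^'n) \<times> (real^'n)) set \<Rightarrow> (real^'n \<Rightarrow> real^'n \<Rightarrow> real) \<Rightarrow> (real^'n \<Rightarrow> real^'n^'n) \<Rightarrow>
     (real^'n \<Rightarrow> real) \<Rightarrow> (real^'n \<Rightarrow> real^'n \<Rightarrow> real^'n) \<Rightarrow> bool" where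
  "conformal_automorphism D F a H t \<longleftrightarrow>
     (\<forall>x. Ck_on 1 (t x) {y. (x, y) \<in> D}) \<and>
     (\<forall>(x, y)\<in>D.
        (\<exists>W W' s. open W \<and> y \<in> W \<and> W \<subseteq> {z. (x, z) \<in> D} \<and> open W' \<and> homeomorphism W W' (t x) s) \<and>
        (\<forall>k>0. t x (k *\<^sub>R y) = (k powr H x) *\<^sub>R t x y) \<and>
        (F x y = 1 \<longleftrightarrow> riem_norm a x (t x y) = 1) \<and>
        (\<forall>m n. finsler_tensor F x y $ m $ n =
           (1 / H x * F x y powr (1 - H x))\<^sup>2 *
           (\<Sum>i\<in>UNIV. \<Sum>j\<in>UNIV.
              a x $ i $ j * jacobian (t x) (at y) $ i $ m * jacobian (t x) (at y) $ j $ n)))"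

end

theory Submission
  imports Defs
begin

text \<open>
  Fix \<open>x\<close> and split \<open>y\<close> orthogonally into an axial part along the unit vector \<open>e\<close> dual to \<open>b\<close> and a
  transverse part of length \<open>r\<close> (which is \<open>q\<close> with tilde) and direction \<open>i\<close>. With \<open>s = r/b\<close> one has
  \<open>F = b f(s)\<close>, and for \<open>g = (F\<^sup>2)''/2\<close>
  \[ g = dF^2 + F (b f'' ds^2 + f' r |di|^2). \]
  The map is \<open>t = F\<^sup>H (sin \<theta> i + cos \<theta> e)\<close> with \<open>\<theta> = \<theta>(s)\<close>, so that
  \[ |dt|^2 = F^{2H} (H^2 dF^2/F^2 + \theta'^2 ds^2 + \sin^2\theta |di|^2). \]
  Comparing the two, conformality with the factor \<open>p\<close> amounts to \<open>\<theta>'\<^sup>2 f = H\<^sup>2 f''\<close> and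
  \<open>sin\<^sup>2 \<theta> f = H\<^sup>2 s f'\<close>; the differential equation for \<open>\<rho>\<close> gives the first condition and the
  formula for \<open>\<mu>\<close> the second. Positive definiteness of \<open>g\<close> yields \<open>f'' > 0\<close>, so the square root in the
  differential equation is the genuine one, and it makes the Jacobian of \<open>t\<close> invertible, so the inverse
  function theorem applies.
\<close>

subsection \<open>Functions of class $C^k$ along lines\<close>

text \<open>\<open>frechet_derivative\<close> at a point sees a whole neighbourhood, so agreement on
  \<open>D\<close> passes to all derivatives because \<open>D\<close> is open.\<close>

lemma Ck_on_cong:
  assumes "open D" "\<And>z. z \<in> D \<Longrightarrow> f z = g z" "Ck_on k f D"
  shows "Ck_on k g D"
  using assms(2,3)
proof (induction k arbitrary: f g)
  case 0
  then show ?case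
    using continuous_on_cong by force
next
  case (Suc k)
  have der: "(g has_derivative frechet_derivative f (at z)) (at z)" if z: "z \<in> D" for z
    using Suc.prems z has_derivative_transform_within_open[OF _ \<open>open D\<close> z]
    by (metis Ck_on.simps(2) frechet_derivative_works)
  have "frechet_derivative f (at z) = frechet_derivative g (at z)" if "z \<in> D" for z
    using frechet_derivative_at der that by blast
  then have "Ck_on k (\<lambda>z. frechet_derivative g (at z) e) D" if "e \<in> Basis" for e
    using Suc.IH[of "\<lambda>z. frechet_derivative f (at z) e"] Suc.prems(2) that by force
  then show ?case
    using der by (auto simp: differentiable_def)
qed

lemma Ck_on_zero: "Ck_on k (\<lambda>z. 0) D"
  by (induction k) (auto simp: frechet_derivative_const)

lemma Ck_on_add:
  assumes "open D" "Ck_on k f D" "Ck_on k g D"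
  shows "Ck_on k (\<lambda>z. f z + g z) D"
  using assms(2,3)
proof (induction k arbitrary: f g)
  case 0
  then show ?case
    by (simp add: continuous_on_add)
next
  case (Suc k)
  have der: "((\<lambda>z. f z + g z) has_derivative
      (\<lambda>v. frechet_derivative f (at z) v + frechet_derivative g (at z) v)) (at z)" if "z \<in> D" for z
    using Suc.prems that by (intro has_derivative_add) (auto simp: frechet_derivative_works)
  have "Ck_on k (\<lambda>z. frechet_derivative (\<lambda>z. f z + g z) (at z) e) D" if "e \<in> Basis" for e
    using Ck_on_cong[OF \<open>open D\<close> _ Suc.IH] Suc.prems that frechet_derivative_at[OF der]
    by (smt (verit, best) Ck_on.simps(2))
  then show ?case
    using der by (auto simp: differentiable_def)
qed

lemma Ck_on_scaleR:
  assumes "open D" "Ck_on k f D"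
  shows "Ck_on k (\<lambda>z. r *\<^sub>R f z) D"
  using assms(2)
proof (induction k arbitrary: f)
  case 0
  then show ?case
    by (simp add: continuous_on_scaleR)
next
  case (Suc k)
  have der: "((\<lambda>z. r *\<^sub>R f z) has_derivative (\<lambda>v. r *\<^sub>R frechet_derivative f (at z) v)) (at z)"
    if "z \<in> D" for z
    using Suc.prems that by (intro has_derivative_scaleR_right) (auto simp: frechet_derivative_works)
  have "Ck_on k (\<lambda>z. frechet_derivative (\<lambda>z. r *\<^sub>R f z) (at z) e) D" if "e \<in> Basis" for e
    using Ck_on_cong[OF \<open>open D\<close> _ Suc.IH] Suc.prems that frechet_derivative_at[OF der]
    by (smt (verit, best) Ck_on.simps(2))
  then show ?case
    using der by (auto simp: differentiable_def)
qed

lemma Ck_on_sum: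
  assumes "open D" "finite I" "\<And>i. i \<in> I \<Longrightarrow> Ck_on k (f i) D"
  shows "Ck_on k (\<lambda>z. \<Sum>i\<in>I. f i z) D"
  using assms(2,3) by (induction I) (simp_all add: Ck_on_zero Ck_on_add \<open>open D\<close>)

text \<open>The derivative along the line is the fixed linear combination of partial derivatives
  with coefficients \<open>d \<bullet> e\<close>, each again restricted to the line, so the
  induction closes without a general chain rule.\<close>

lemma Ck_on_line:
  fixes z d :: "'a::euclidean_space"
  assumes "open T" "\<And>s. s \<in> T \<Longrightarrow> z + s *\<^sub>R d \<in> D" "Ck_on k g D"
  shows "Ck_on k (\<lambda>s::real. g (z + s *\<^sub>R d)) T"
  using assms(3)
proof (induction k arbitrary: g)
  case 0
  have "continuous_on T (\<lambda>s. z + s *\<^sub>R d)"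
    by (intro continuous_intros)
  then show ?case
    using 0 continuous_on_compose2[of D g T "\<lambda>s. z + s *\<^sub>R d"] assms(2) by auto
next
  case (Suc k)
  let ?L = "\<lambda>s. z + s *\<^sub>R d"
  have der: "((\<lambda>s. g (?L s)) has_derivative (\<lambda>h. h *\<^sub>R frechet_derivative g (at (?L s)) d)) (at s)"
    if s: "s \<in> T" for s
  proof -
    have "(?L has_derivative (\<lambda>h. h *\<^sub>R d)) (at s)"
      by (auto intro!: derivative_eq_intros)
    moreover have g: "(g has_derivative frechet_derivative g (at (?L s))) (at (?L s))"
      using Suc.prems assms(2) s by (simp add: frechet_derivative_works)
    ultimately have "((\<lambda>s. g (?L s)) has_derivative (\<lambda>h. frechet_derivative g (at (?L s)) (h *\<^sub>R d))) (at s)"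
      by (rule has_derivative_compose)
    then show ?thesis
      using linear_scale[OF has_derivative_linear[OF g]] by simp
  qed
  have "frechet_derivative (\<lambda>s. g (?L s)) (at s) 1 =
      (\<Sum>e\<in>Basis. (d \<bullet> e) *\<^sub>R frechet_derivative g (at (?L s)) e)" if s: "s \<in> T" for s
  proof -
    have lin: "linear (frechet_derivative g (at (?L s)))"
      using Suc.prems assms(2) s by (simp add: linear_frechet_derivative)
    have "frechet_derivative (\<lambda>s. g (?L s)) (at s) 1 = frechet_derivative g (at (?L s)) d"
      using frechet_derivative_at[OF der[OF s], symmetric] by simp
    also have "\<dots> = frechet_derivative g (at (?L s)) (\<Sum>e\<in>Basis. (d \<bullet> e) *\<^sub>R e)"
      by (simp add: euclidean_representation)
    finally show ?thesis
      using lin by (simp add: linear_sum linear_scale o_def)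
  qed
  moreover have "Ck_on k (\<lambda>s. \<Sum>e\<in>Basis. (d \<bullet> e) *\<^sub>R frechet_derivative g (at (?L s)) e) T"
    using Suc.prems by (intro Ck_on_sum Ck_on_scaleR Suc.IH \<open>open T\<close>) auto
  ultimately have "Ck_on k (\<lambda>s. frechet_derivative (\<lambda>s. g (?L s)) (at s) 1) T"
    using Ck_on_cong[OF \<open>open T\<close>] by (metis (no_types, lifting))
  then show ?case
    using der by (auto simp: differentiable_def)
qed

text \<open>On the reals the only basis vector is 1, so \<open>Ck_on\<close> can be read in terms of
  \<open>deriv\<close>.\<close>

lemma Ck_on_Suc_real:
  fixes f :: "real \<Rightarrow> real"
  assumes "open T" "Ck_on (Suc k) f T"
  shows "\<And>s. s \<in> T \<Longrightarrow> (f has_real_derivative deriv f s) (at s)" and "Ck_on k (deriv f) T"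
proof -
  show der: "(f has_real_derivative deriv f s) (at s)" if "s \<in> T" for s
    using assms(2) that by (auto simp: DERIV_deriv_iff_real_differentiable)
  have "frechet_derivative f (at s) 1 = deriv f s" if "s \<in> T" for s
    using frechet_derivative_at[OF der[OF that, unfolded has_field_derivative_def], symmetric] by simp
  then show "Ck_on k (deriv f) T"
    using assms(2) Ck_on_cong[OF \<open>open T\<close>, of "\<lambda>s. frechet_derivative f (at s) 1"] by simp
qed

subsection \<open>Axially symmetric Finsler functions\<close>

text \<open>The geometry of one tangent space: \<open>ip\<close> will be the Riemannian inner
  product, \<open>e\<close> the unit vector dual to the 1-form and \<open>c\<close> the norm of that
  form. Then \<open>form\<close>, \<open>radius\<close>, \<open>dir\<close> and \<open>slope\<close>
  are b, q tilde, i and w tilde.\<close>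

locale axial =
  fixes ip :: "'a::euclidean_space \<Rightarrow> 'a \<Rightarrow> real" and e :: 'a and c :: real
  assumes bounded_bilinear_ip: "bounded_bilinear ip"
    and ip_commute: "ip u v = ip v u"
    and ip_pos: "v \<noteq> 0 \<Longrightarrow> 0 < ip v v"
    and ip_e_e: "ip e e = 1"
    and c_pos: "0 < c"
begin

sublocale ip: bounded_bilinear ip
  by (rule bounded_bilinear_ip)

definition form :: "'a \<Rightarrow> real" where "form y = c * ip e y"

definition perp :: "'a \<Rightarrow> 'a" where "perp y = y - ip e y *\<^sub>R e"

definition radius :: "'a \<Rightarrow> real" where "radius y = sqrt (ip (perp y) (perp y))"

definition dir :: "'a \<Rightarrow> 'a" where "dir y = (1 / radius y) *\<^sub>R perp y"

definition slope :: "'a \<Rightarrow> real" where "slope y = radius y / form y"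

text \<open>\<open>ddir\<close> and \<open>dslope\<close> are the derivatives of \<open>dir\<close>
  and \<open>slope\<close>, written as closed formulas so that they can be used
  algebraically.\<close>

definition ddir :: "'a \<Rightarrow> 'a \<Rightarrow> 'a" where
  "ddir y v = (1 / radius y) *\<^sub>R (perp v - ip (dir y) v *\<^sub>R dir y)"

definition dslope :: "'a \<Rightarrow> 'a \<Rightarrow> real" where
  "dslope y v = (ip (dir y) v - slope y * form v) / form y"

lemmas ip_simps = ip.add_left ip.add_right ip.diff_left ip.diff_right
  ip.scaleR_left ip.scaleR_right ip.zero_left ip.zero_right ip.minus_left ip.minus_right

lemma bounded_linear_form: "bounded_linear form"
  unfolding form_def
  using bounded_linear_compose[OF bounded_linear_mult_right ip.bounded_linear_right] by (simp add: o_def)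

lemma bounded_linear_perp: "bounded_linear perp"
  unfolding perp_def
  by (intro bounded_linear_sub bounded_linear_ident
      bounded_linear_compose[OF bounded_linear_scaleR_left ip.bounded_linear_right])

lemma ip_e_perp [simp]: "ip e (perp v) = 0"
  by (simp add: perp_def ip_simps ip_e_e)

lemma ip_perp_e [simp]: "ip (perp v) e = 0"
  using ip_e_perp ip_commute by metis

lemma ip_nonneg: "0 \<le> ip v v"
  using ip_pos[of v] by (cases "v = 0") (auto simp: ip.zero_left)

lemma ip_perp_perp: "ip (perp u) (perp v) = ip (perp u) v"
  by (simp add: perp_def[of v] ip_simps)

lemma ip_e_dir [simp]: "ip e (dir y) = 0" and ip_dir_e [simp]: "ip (dir y) e = 0"
  by (simp_all add: dir_def ip_simps)

lemma radius_sq: "(radius y)\<^sup>2 = ip (perp y) (perp y)"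
  by (simp add: radius_def ip_nonneg)

lemma ip_dir_dir: "0 < radius y \<Longrightarrow> ip (dir y) (dir y) = 1"
  using radius_sq[of y, symmetric] by (simp add: dir_def ip_simps power2_eq_square)

lemma ip_dir_perp: "ip (dir y) (perp v) = ip (dir y) v"
  by (simp add: dir_def ip_simps ip_perp_perp)

lemma ip_e_ddir [simp]: "ip e (ddir y v) = 0" and ip_ddir_e [simp]: "ip (ddir y v) e = 0"
  by (simp_all add: ddir_def ip_simps)

lemma ip_dir_ddir: "0 < radius y \<Longrightarrow> ip (dir y) (ddir y v) = 0"
  by (simp add: ddir_def ip_simps ip_dir_perp ip_dir_dir)

text \<open>\<open>radius y\<close> times \<open>ddir y\<close> is the orthogonal projection off
  \<open>e\<close> and \<open>dir y\<close>; it is symmetric and idempotent. This links the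
  transverse part of the Hessian to the length of the transverse part of the map.\<close>

lemma ip_ddir_ddir:
  assumes "0 < radius y"
  shows "radius y * ip (ddir y u) (ddir y v) = ip (ddir y u) v"
proof -
  have "ip (ddir y u) (dir y) = 0"
    using ip_dir_ddir[OF assms] ip_commute by metis
  then have "radius y * ip (ddir y u) (ddir y v) = ip (ddir y u) (perp v)"
    using assms by (subst (2) ddir_def) (simp add: ip_simps)
  also have "\<dots> = ip (ddir y u) v"
    by (simp add: perp_def[of v] ip_simps)
  finally show ?thesis .
qed

lemma has_derivative_radius:
  assumes "0 < radius y"
  shows "(radius has_derivative ip (dir y)) (at y)"
proof -
  have "((\<lambda>z. ip (perp z) (perp z)) has_derivative (\<lambda>v. ip (perp y) (perp v) + ip (perp v) (perp y))) (at y)"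
    by (intro ip.FDERIV bounded_linear_imp_has_derivative bounded_linear_perp)
  moreover have "ip (perp y) (perp y) > 0"
    using assms radius_sq[of y] by (metis zero_less_power)
  ultimately have "((\<lambda>z. sqrt (ip (perp z) (perp z))) has_derivative
      (\<lambda>v. (ip (perp y) (perp v) + ip (perp v) (perp y)) * (inverse (sqrt (ip (perp y) (perp y))) / 2))) (at y)"
    by (rule has_derivative_real_sqrt[rotated])
  moreover have "(\<lambda>v. (ip (perp y) (perp v) + ip (perp v) (perp y)) * (inverse (sqrt (ip (perp y) (perp y))) / 2)) = ip (dir y)"
  proof
    fix v
    have "ip (perp v) (perp y) = ip (perp y) v"
      by (metis ip_commute ip_perp_perp)
    then show "(ip (perp y) (perp v) + ip (perp v) (perp y)) * (inverse (sqrt (ip (perp y) (perp y))) / 2)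
        = ip (dir y) v"
      by (simp add: ip_perp_perp[of y v] dir_def ip.scaleR_left radius_def[of y] field_simps)
  qed
  ultimately show ?thesis
    by (simp add: radius_def[abs_def])
qed

lemma has_derivative_dir:
  assumes "0 < radius y"
  shows "(dir has_derivative ddir y) (at y)"
proof -
  have "((\<lambda>z. (1 / radius z) *\<^sub>R perp z) has_derivative
      (\<lambda>v. (1 / radius y) *\<^sub>R perp v + (- ip (dir y) v / (radius y)\<^sup>2) *\<^sub>R perp y)) (at y)"
    using assms
    by (auto intro!: derivative_eq_intros has_derivative_radius
        bounded_linear_imp_has_derivative[OF bounded_linear_perp] simp: power2_eq_square divide_simps)
  moreover have "(\<lambda>v. (1 / radius y) *\<^sub>R perp v + (- ip (dir y) v / (radius y)\<^sup>2) *\<^sub>R perp y) = ddir y"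
    using assms by (auto simp: ddir_def dir_def[of y] fun_eq_iff algebra_simps power2_eq_square)
  ultimately show ?thesis
    by (simp add: dir_def[abs_def])
qed

lemma has_derivative_slope:
  assumes "0 < radius y" "0 < form y"
  shows "(slope has_derivative dslope y) (at y)"
proof -
  have "((\<lambda>z. radius z / form z) has_derivative
      (\<lambda>v. (ip (dir y) v * form y - radius y * form v) / (form y * form y))) (at y)"
    using assms
    by (intro has_derivative_divide' has_derivative_radius
        bounded_linear_imp_has_derivative[OF bounded_linear_form]) auto
  moreover have "(\<lambda>v. (ip (dir y) v * form y - radius y * form v) / (form y * form y)) = dslope y"
    using assms by (auto simp: dslope_def slope_def fun_eq_iff divide_simps)
  ultimately show ?thesis
    by (simp add: slope_def[abs_def])
qed

lemma radius_pos_slope: "0 < radius y \<Longrightarrow> 0 < form y \<Longrightarrow> 0 < slope y"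
  by (simp add: slope_def)

text \<open>In the plane of \<open>e\<close> and \<open>dir y\<close>, a line with constant
  \<open>form\<close> is parametrized by its own slope. It serves as a right inverse of
  \<open>slope\<close>.\<close>

lemma slope_line:
  assumes "0 < form y" "0 < s"
  shows "form ((form y / c) *\<^sub>R e + s *\<^sub>R form y *\<^sub>R dir y) = form y"
    and "0 < radius y \<Longrightarrow> slope ((form y / c) *\<^sub>R e + s *\<^sub>R form y *\<^sub>R dir y) = s"
proof -
  let ?z = "(form y / c) *\<^sub>R e + s *\<^sub>R form y *\<^sub>R dir y"
  show f: "form ?z = form y"
    using c_pos by (simp add: form_def ip_simps ip_e_e)
  assume r: "0 < radius y"
  have "perp ?z = (s * form y) *\<^sub>R dir y"
    by (simp add: perp_def ip_simps ip_e_e)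
  then have "ip (perp ?z) (perp ?z) = (s * form y)\<^sup>2"
    by (simp add: ip_simps ip_dir_dir[OF r] power2_eq_square)
  then have "radius ?z = s * form y"
    using assms by (simp add: radius_def)
  then show "slope ?z = s"
    unfolding slope_def f using assms by simp
qed

lemma line_through:
  assumes "0 < form y" "0 < radius y"
  shows "(form y / c) *\<^sub>R e + slope y *\<^sub>R form y *\<^sub>R dir y = y"
proof -
  have "slope y * form y = radius y"
    using assms by (simp add: slope_def)
  moreover have "form y / c = ip e y"
    using c_pos by (simp add: form_def)
  ultimately show ?thesis
    using assms by (simp add: dir_def perp_def)
qed

lemma form_dir_slope_scaleR:
  assumes "0 < k"
  shows "form (k *\<^sub>R y) = k * form y" "dir (k *\<^sub>R y) = dir y" "slope (k *\<^sub>R y) = slope y"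
proof -
  have p: "perp (k *\<^sub>R y) = k *\<^sub>R perp y"
    by (simp add: perp_def ip_simps scaleR_diff_right)
  have r: "radius (k *\<^sub>R y) = k * radius y"
    using assms by (simp add: radius_def p ip_simps real_sqrt_mult)
  show f: "form (k *\<^sub>R y) = k * form y"
    by (simp add: form_def ip_simps)
  show "dir (k *\<^sub>R y) = dir y" "slope (k *\<^sub>R y) = slope y"
    using assms by (simp_all add: dir_def p r f slope_def)
qed

text \<open>\<open>f\<close> starts as an arbitrary function. On the line of
  \<open>slope_line\<close> it equals \<open>g\<close> divided by the constant
  \<open>form y\<close>, so it inherits the regularity of \<open>g\<close>.\<close>

lemma slope_profile_derivs:
  fixes g :: "'b::euclidean_space \<times> 'a \<Rightarrow> real" and f :: "real \<Rightarrow> real"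
  assumes D: "open D" "Ck_on 2 g D"
    and pos: "\<And>z. (x, z) \<in> D \<Longrightarrow> 0 < form z \<and> 0 < radius z"
    and g: "\<And>z. (x, z) \<in> D \<Longrightarrow> g (x, z) = form z * f (slope z)"
    and y: "(x, y) \<in> D"
  shows "(f has_real_derivative deriv f (slope y)) (at (slope y))"
    and "(deriv f has_real_derivative deriv (deriv f) (slope y)) (at (slope y))"
    and "isCont (deriv (deriv f)) (slope y)"
proof -
  define z d where "z = (x, (form y / c) *\<^sub>R e)" and "d = (0::'b, form y *\<^sub>R dir y)"
  have zd: "z + s *\<^sub>R d = (x, (form y / c) *\<^sub>R e + s *\<^sub>R form y *\<^sub>R dir y)" for s
    by (simp add: z_def d_def)
  \<comment> \<open>Positivity is required because \<open>radius\<close> is a nonnegative root: only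
    for positive parameters is the slope equal to \<open>s\<close>.\<close>
  define T where "T = {0<..} \<inter> (\<lambda>s. z + s *\<^sub>R d) -` D"
  note b = pos[OF y, THEN conjunct1] and r = pos[OF y, THEN conjunct2]
  have T: "open T"
    unfolding T_def by (intro open_Int open_greaterThan open_vimage \<open>open D\<close> continuous_intros)
  have y_T: "slope y \<in> T"
    using y radius_pos_slope[OF r b] by (simp add: T_def zd line_through b r del: scaleR_scaleR)
  have "f s = (1 / form y) *\<^sub>R g (z + s *\<^sub>R d)" if "s \<in> T" for s
  proof -
    from that have s: "0 < s" "(x, (form y / c) *\<^sub>R e + s *\<^sub>R form y *\<^sub>R dir y) \<in> D"
      by (auto simp: T_def zd)
    show ?thesis
      unfolding zd g[OF s(2)] slope_line(1)[OF b s(1)] slope_line(2)[OF b s(1) r] using b by simp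
  qed
  moreover have "Ck_on 2 (\<lambda>s. (1 / form y) *\<^sub>R g (z + s *\<^sub>R d)) T"
    by (intro Ck_on_scaleR Ck_on_line[OF _ _ D(2)] T) (simp add: T_def)
  ultimately have C2: "Ck_on (Suc (Suc 0)) f T"
    using Ck_on_cong[OF T, of "\<lambda>s. (1 / form y) *\<^sub>R g (z + s *\<^sub>R d)" f] by (simp add: numeral_2_eq_2 del: Ck_on.simps)
  show "(f has_real_derivative deriv f (slope y)) (at (slope y))"
    by (rule Ck_on_Suc_real(1)[OF T C2 y_T])
  note C1 = Ck_on_Suc_real(2)[OF T C2]
  show "(deriv f has_real_derivative deriv (deriv f) (slope y)) (at (slope y))"
    by (rule Ck_on_Suc_real(1)[OF T C1 y_T])
  show "isCont (deriv (deriv f)) (slope y)"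
    using Ck_on_Suc_real(2)[OF T C1] T y_T by (simp add: continuous_on_eq_continuous_at)
qed

end

section \<open>Metric functions with a profile in the slope: first and second derivatives\<close>

locale axial_metric = axial +
  fixes E :: "'a set" and f f1 f2 :: "real \<Rightarrow> real"
  assumes open_E: "open E"
    and form_pos: "y \<in> E \<Longrightarrow> 0 < form y"
    and radius_pos: "y \<in> E \<Longrightarrow> 0 < radius y"
    and deriv_f: "y \<in> E \<Longrightarrow> (f has_real_derivative f1 (slope y)) (at (slope y))"
    and deriv_f1: "y \<in> E \<Longrightarrow> (f1 has_real_derivative f2 (slope y)) (at (slope y))"
begin

definition met :: "'a \<Rightarrow> real" where "met y = form y * f (slope y)"

definition dmet :: "'a \<Rightarrow> 'a \<Rightarrow> real" where
  "dmet y v = (f (slope y) - slope y * f1 (slope y)) * form v + f1 (slope y) * ip (dir y) v"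

text \<open>This is half the Hessian of the square of \<open>met\<close>: the product of
  differentials plus \<open>met\<close> times the Hessian of \<open>met\<close>, the latter split
  into a part along \<open>dslope\<close> and a transverse part.\<close>

definition gmet :: "'a \<Rightarrow> 'a \<Rightarrow> 'a \<Rightarrow> real" where
  "gmet y u v = dmet y u * dmet y v +
     met y * (f2 (slope y) * form y * dslope y u * dslope y v + f1 (slope y) * ip (ddir y u) v)"

lemma has_derivative_comp_slope:
  assumes "y \<in> E" "(h has_real_derivative h') (at (slope y))"
  shows "((\<lambda>z. h (slope z)) has_derivative (\<lambda>v. h' * dslope y v)) (at y)"
  using has_derivative_compose[OF has_derivative_slope[OF radius_pos form_pos]
      assms(2)[unfolded has_field_derivative_def]] assms(1)
  by blast

lemma has_derivative_met:
  assumes "y \<in> E"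
  shows "(met has_derivative dmet y) (at y)"
proof -
  have "((\<lambda>z. form z * f (slope z)) has_derivative
      (\<lambda>v. form y * (f1 (slope y) * dslope y v) + form v * f (slope y))) (at y)"
    by (intro has_derivative_mult has_derivative_comp_slope deriv_f assms
        bounded_linear_imp_has_derivative[OF bounded_linear_form])
  moreover have "(\<lambda>v. form y * (f1 (slope y) * dslope y v) + form v * f (slope y)) = dmet y"
    using form_pos[OF assms] by (simp add: dmet_def dslope_def fun_eq_iff field_simps)
  ultimately show ?thesis
    by (simp add: met_def[abs_def])
qed

text \<open>Differentiating \<open>f - s * f1\<close> leaves only \<open>- s * f2\<close>; together
  with the \<open>f2\<close> term of the other summand this reassembles
  \<open>form y * dslope y v\<close>.\<close>

lemma has_derivative_dmet:
  assumes "y \<in> E"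
  shows "((\<lambda>z. dmet z v) has_derivative
    (\<lambda>u. f2 (slope y) * form y * dslope y u * dslope y v + f1 (slope y) * ip (ddir y u) v)) (at y)"
proof -
  let ?s = "slope y"
  have s: "(slope has_derivative dslope y) (at y)"
    by (intro has_derivative_slope radius_pos form_pos assms)
  have "((\<lambda>z. dmet z v) has_derivative
    (\<lambda>u. (f1 ?s * dslope y u - (?s * (f2 ?s * dslope y u) + dslope y u * f1 ?s)) * form v
         + (f1 ?s * ip (ddir y u) v + f2 ?s * dslope y u * ip (dir y) v))) (at y)"
    unfolding dmet_def
    by (intro has_derivative_add has_derivative_diff has_derivative_mult has_derivative_mult_left
        has_derivative_comp_slope deriv_f deriv_f1 assms s
        bounded_linear.has_derivative[OF ip.bounded_linear_left] has_derivative_dir radius_pos)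
  moreover have "(\<lambda>u. (f1 ?s * dslope y u - (?s * (f2 ?s * dslope y u) + dslope y u * f1 ?s)) * form v
         + (f1 ?s * ip (ddir y u) v + f2 ?s * dslope y u * ip (dir y) v)) =
    (\<lambda>u. f2 ?s * form y * dslope y u * dslope y v + f1 ?s * ip (ddir y u) v)"
    using form_pos[OF assms] by (simp add: dslope_def[of y v] fun_eq_iff field_simps)
  ultimately show ?thesis
    by simp
qed

lemma bilinear_gmet: "bilinear (gmet y)"
proof -
  note lin = bounded_linear_form[THEN bounded_linear.linear] bounded_linear_perp[THEN bounded_linear.linear]
  have "linear (dmet y)" "linear (dslope y)" "linear (ddir y)"
    by (rule linearI; simp add: dmet_def dslope_def ddir_def linear_add[OF lin(1)] linear_add[OF lin(2)]
        linear_scale[OF lin(1)] linear_scale[OF lin(2)] ip_simps algebra_simps add_divide_distrib diff_divide_distrib)+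
  note lin2 = this
  show ?thesis
    unfolding bilinear_def
    by (intro conjI allI linearI; simp add: gmet_def linear_add[OF lin2(1)] linear_add[OF lin2(2)]
        linear_add[OF lin2(3)] linear_scale[OF lin2(1)] linear_scale[OF lin2(2)]
        linear_scale[OF lin2(3)] ip_simps algebra_simps)
qed

text \<open>Positive definiteness is tested on one vector for which \<open>dmet\<close> and
  \<open>ddir\<close> vanish, so that \<open>gmet\<close> reduces to \<open>f2\<close> times a
  positive factor.\<close>

lemma f2_pos:
  assumes y: "y \<in> E" and met: "0 < met y" and f1: "f1 (slope y) \<noteq> 0"
    and pos: "\<And>v. v \<noteq> 0 \<Longrightarrow> 0 < gmet y v v"
  shows "0 < f2 (slope y)"
proof -
  let ?s = "slope y"
  \<comment> \<open>\<^term>\<open>v\<close> is tangent to the level set of \<^term>\<open>met\<close> in the plane of \<^term>\<open>e\<close> and \<^term>\<open>dir y\<close>.\<close>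
  define v where "v = (- f1 ?s / c) *\<^sub>R e + (f ?s - ?s * f1 ?s) *\<^sub>R dir y"
  note b = form_pos[OF y] and r = radius_pos[OF y]
  have fs: "0 < f ?s"
    using met b by (simp add: met_def zero_less_mult_iff)
  have form_v: "form v = - f1 ?s"
    using c_pos by (simp add: form_def v_def ip_simps ip_e_e)
  have dir_v: "ip (dir y) v = f ?s - ?s * f1 ?s"
    by (simp add: v_def ip_simps ip_dir_dir r)
  have "perp v = (f ?s - ?s * f1 ?s) *\<^sub>R dir y"
    by (simp add: perp_def v_def ip_simps ip_e_e)
  then have "ddir y v = 0"
    by (simp add: ddir_def dir_v)
  moreover have "dmet y v = 0"
    by (simp add: dmet_def form_v dir_v)
  moreover have "dslope y v = f ?s / form y"
    by (simp add: dslope_def form_v dir_v)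
  ultimately have "gmet y v v = met y * (f2 ?s * form y * (f ?s / form y) * (f ?s / form y))"
    by (simp add: gmet_def ip_simps)
  also have "\<dots> = f2 ?s * (met y * (f ?s)\<^sup>2 / form y)"
    using b by (simp add: power2_eq_square)
  finally have "gmet y v v = f2 ?s * (met y * (f ?s)\<^sup>2 / form y)" .
  moreover have "v \<noteq> 0"
    using form_v f1 by (auto simp: form_def ip_simps)
  ultimately show ?thesis
    using pos[of v] met fs b zero_less_mult_pos2[of "f2 ?s" "met y * (f ?s)\<^sup>2 / form y"] by simp
qed

end

text \<open>\<^term>\<open>X\<close> and \<^term>\<open>Y\<close> are the sine and cosine of the angle between the image and the axis \<^term>\<open>e\<close>,
  and \<^term>\<open>w\<close> is the derivative of that angle. The last two assumptions are the conformality conditions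
  transverse to and inside the plane of \<^term>\<open>e\<close> and \<^term>\<open>dir y\<close>.\<close>

locale axial_map = axial_metric +
  fixes X Y w :: "real \<Rightarrow> real" and H :: real
  assumes H_pos: "0 < H"
    and met_pos: "y \<in> E \<Longrightarrow> 0 < met y"
    and gmet_pos: "y \<in> E \<Longrightarrow> v \<noteq> 0 \<Longrightarrow> 0 < gmet y v v"
    and isCont_w: "y \<in> E \<Longrightarrow> isCont w (slope y)"
    and deriv_X: "y \<in> E \<Longrightarrow> (X has_real_derivative Y (slope y) * w (slope y)) (at (slope y))"
    and deriv_Y: "y \<in> E \<Longrightarrow> (Y has_real_derivative - X (slope y) * w (slope y)) (at (slope y))"
    and X_Y: "y \<in> E \<Longrightarrow> (X (slope y))\<^sup>2 + (Y (slope y))\<^sup>2 = 1"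
    and X_sq: "y \<in> E \<Longrightarrow> (X (slope y))\<^sup>2 * f (slope y) = H\<^sup>2 * slope y * f1 (slope y)"
    and w_sq: "y \<in> E \<Longrightarrow> (w (slope y))\<^sup>2 * f (slope y) = H\<^sup>2 * f2 (slope y)"
begin

definition tmap :: "'a \<Rightarrow> 'a" where
  "tmap y = (met y powr H) *\<^sub>R (X (slope y) *\<^sub>R dir y + Y (slope y) *\<^sub>R e)"

definition dtmap :: "'a \<Rightarrow> 'a \<Rightarrow> 'a" where
  "dtmap y v =
     (H * met y powr (H - 1) * dmet y v) *\<^sub>R (X (slope y) *\<^sub>R dir y + Y (slope y) *\<^sub>R e) +
     (met y powr H) *\<^sub>R ((dslope y v * w (slope y)) *\<^sub>R (Y (slope y) *\<^sub>R dir y - X (slope y) *\<^sub>R e)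
       + X (slope y) *\<^sub>R ddir y v)"

lemma has_derivative_tmap:
  assumes y: "y \<in> E"
  shows "(tmap has_derivative dtmap y) (at y)"
proof -
  let ?s = "slope y"
  have "((\<lambda>z. met z powr H) has_derivative (\<lambda>v. H * met y powr (H - 1) * dmet y v)) (at y)"
    using has_derivative_powr[OF has_derivative_met[OF y] has_derivative_const[of H] met_pos[OF y]]
    by (simp add: powr_diff met_pos[OF y] abs_of_pos mult_ac)
  then have "(tmap has_derivative
      (\<lambda>v. met y powr H *\<^sub>R ((X ?s *\<^sub>R ddir y v + (Y ?s * w ?s * dslope y v) *\<^sub>R dir y) +
             (- X ?s * w ?s * dslope y v) *\<^sub>R e) +
           (H * met y powr (H - 1) * dmet y v) *\<^sub>R (X ?s *\<^sub>R dir y + Y ?s *\<^sub>R e))) (at y)"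
    unfolding tmap_def[abs_def]
    by (intro has_derivative_scaleR has_derivative_add has_derivative_scaleR_left
        has_derivative_comp_slope deriv_X deriv_Y y has_derivative_dir radius_pos)
  moreover have "(\<lambda>v. met y powr H *\<^sub>R ((X ?s *\<^sub>R ddir y v + (Y ?s * w ?s * dslope y v) *\<^sub>R dir y) +
             (- X ?s * w ?s * dslope y v) *\<^sub>R e) +
           (H * met y powr (H - 1) * dmet y v) *\<^sub>R (X ?s *\<^sub>R dir y + Y ?s *\<^sub>R e)) = dtmap y"
    by (auto simp: dtmap_def fun_eq_iff algebra_simps)
  ultimately show ?thesis
    by simp
qed

lemma ip_tmap:
  assumes y: "y \<in> E"
  shows "ip (tmap y) (tmap y) = (met y powr H)\<^sup>2"
proof -
  have "ip (tmap y) (tmap y) = (met y powr H)\<^sup>2 * ((X (slope y))\<^sup>2 + (Y (slope y))\<^sup>2)"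
    by (simp add: tmap_def ip_simps ip_dir_dir radius_pos y ip_e_e power2_eq_square algebra_simps)
  then show ?thesis
    by (simp add: X_Y y)
qed

text \<open>The three parts of \<open>dtmap\<close> (radial, angular, transverse) are mutually
  orthogonal. The conformal factor normalizes the radial part to \<open>dmet\<close>;
  \<open>w_sq\<close> and \<open>X_sq\<close> match the other two with the Hessian of
  \<open>met\<close>.\<close>

lemma gmet_eq:
  assumes y: "y \<in> E"
  shows "gmet y u v = (1 / H * met y powr (1 - H))\<^sup>2 * ip (dtmap y u) (dtmap y v)"
proof -
  let ?s = "slope y" and ?P = "met y powr H"
  note b = form_pos[OF y] and r = radius_pos[OF y] and m = met_pos[OF y]
  have d: "ip (dir y) (dir y) = 1" "ip (dir y) (ddir y v) = 0" "ip (ddir y u) (dir y) = 0"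
    using ip_dir_dir[OF r] ip_dir_ddir[OF r] ip_commute by metis+
  have P: "met y powr (H - 1) = ?P / met y" "met y powr (1 - H) = met y / ?P" "0 < ?P"
    using m by (simp_all add: powr_diff)
  have "ip (dtmap y u) (dtmap y v) =
      (H * (?P / met y))\<^sup>2 * dmet y u * dmet y v * ((X ?s)\<^sup>2 + (Y ?s)\<^sup>2) +
      ?P\<^sup>2 * (dslope y u * dslope y v * (w ?s)\<^sup>2 * ((X ?s)\<^sup>2 + (Y ?s)\<^sup>2)
        + (X ?s)\<^sup>2 * ip (ddir y u) (ddir y v))"
  proof -
    \<comment> \<open>An opaque name for the quotient keeps the expansion polynomial.\<close>
    define k where "k = H * (?P / met y)"
    show ?thesis
      unfolding dtmap_def P(1) k_def[symmetric]
      by (simp add: ip_simps d ip_e_e) (simp add: power2_eq_square algebra_simps)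
  qed
  then have "(1 / H * met y powr (1 - H))\<^sup>2 * ip (dtmap y u) (dtmap y v) =
      dmet y u * dmet y v +
      (met y)\<^sup>2 / H\<^sup>2 * (dslope y u * dslope y v * (w ?s)\<^sup>2 + (X ?s)\<^sup>2 * ip (ddir y u) (ddir y v))"
    using P(3) m H_pos unfolding P(2) X_Y[OF y]
    by (simp add: field_simps)
  \<comment> \<open>One factor \<open>met y\<close> is opened to supply the \<open>f\<close> that
    \<open>w_sq\<close> and \<open>X_sq\<close> require.\<close>
  also have "\<dots> = dmet y u * dmet y v +
      met y * form y / H\<^sup>2 * (dslope y u * dslope y v * ((w ?s)\<^sup>2 * f ?s) + ((X ?s)\<^sup>2 * f ?s) * ip (ddir y u) (ddir y v))"
    by (simp add: met_def power2_eq_square algebra_simps)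
  also have "\<dots> = dmet y u * dmet y v +
      met y * form y * (dslope y u * dslope y v * f2 ?s + ?s * f1 ?s * ip (ddir y u) (ddir y v))"
    unfolding w_sq[OF y] X_sq[OF y] using H_pos by (simp add: field_simps)
  also have "\<dots> = gmet y u v"
    using b unfolding gmet_def ip_ddir_ddir[OF r, of u v, symmetric] by (simp add: slope_def algebra_simps)
  finally show ?thesis ..
qed

lemma linear_dtmap: "y \<in> E \<Longrightarrow> bounded_linear (dtmap y)"
  using has_derivative_tmap has_derivative_bounded_linear by blast

text \<open>All profiles occurring in \<open>dtmap\<close> are differentiable except
  \<open>w\<close>, for which continuity is an assumption of the locale.\<close>

lemma continuous_on_dtmap: "continuous_on E (\<lambda>y. dtmap y v)"
proof -
  have slope: "continuous_on E slope"
    by (meson differentiableI differentiable_imp_continuous_on differentiable_at_imp_differentiable_on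
        has_derivative_slope radius_pos form_pos)
  have dir: "continuous_on E dir"
    by (meson differentiableI differentiable_imp_continuous_on differentiable_at_imp_differentiable_on
        has_derivative_dir radius_pos)
  have rad: "continuous_on E radius"
    by (meson differentiableI differentiable_imp_continuous_on differentiable_at_imp_differentiable_on
        has_derivative_radius radius_pos)
  have met: "continuous_on E met"
    by (meson differentiableI differentiable_imp_continuous_on differentiable_at_imp_differentiable_on
        has_derivative_met)
  have form: "continuous_on E form"
    by (simp add: bounded_linear_form linear_continuous_on)
  have comp: "continuous_on E (\<lambda>y. h (slope y))" if "\<And>y. y \<in> E \<Longrightarrow> isCont h (slope y)" for h :: "real \<Rightarrow> real"
    using that continuous_on_compose[OF slope, of h]
    by (auto simp: o_def continuous_on_eq_continuous_within intro: continuous_at_imp_continuous_within)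
  have cw: "continuous_on E (\<lambda>y. w (slope y))"
    by (intro comp isCont_w)
  have cf: "continuous_on E (\<lambda>y. f (slope y))" "continuous_on E (\<lambda>y. f1 (slope y))"
    "continuous_on E (\<lambda>y. X (slope y))" "continuous_on E (\<lambda>y. Y (slope y))"
    by (intro comp; blast intro: DERIV_isCont deriv_f deriv_f1 deriv_X deriv_Y)+
  have dmet: "continuous_on E (\<lambda>y. dmet y v)"
    unfolding dmet_def by (intro continuous_intros ip.continuous_on slope dir cf)
  have nz: "form y \<noteq> 0" "radius y \<noteq> 0" "met y \<noteq> 0" if "y \<in> E" for y
    using form_pos radius_pos met_pos that by force+
  have dslope: "continuous_on E (\<lambda>y. dslope y v)"
    unfolding dslope_def using nz by (intro continuous_intros ip.continuous_on slope dir form) auto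
  have ddir: "continuous_on E (\<lambda>y. ddir y v)"
    unfolding ddir_def using nz by (intro continuous_intros ip.continuous_on slope dir rad) auto
  show ?thesis
    unfolding dtmap_def using nz
    by (intro continuous_intros met dmet dslope ddir dir cf cw) auto
qed

lemma Ck_on_1_tmap: "Ck_on 1 tmap E"
proof -
  have "continuous_on E (\<lambda>z. frechet_derivative tmap (at z) u)" for u
    using continuous_on_dtmap[of u]
    by (rule continuous_on_eq) (metis frechet_derivative_at has_derivative_tmap)
  then show ?thesis
    using has_derivative_tmap by (auto simp: differentiable_def)
qed

text \<open>A kernel vector of \<open>dtmap y\<close> would be null for \<open>gmet\<close> by
  \<open>gmet_eq\<close>, against positive definiteness. So the derivative has a left inverse, and
  the inverse function theorem applies.\<close>

lemma tmap_local_homeomorphism: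
  assumes y: "y \<in> E"
  obtains W W' s where "open W" "y \<in> W" "W \<subseteq> E" "open W'" "homeomorphism W W' tmap s"
proof -
  define D where "D y = Blinfun (dtmap y)" for y
  have D: "blinfun_apply (D z) = dtmap z" if "z \<in> E" for z
    using that linear_dtmap by (simp add: D_def bounded_linear_Blinfun_apply)
  have "inj (dtmap y)"
  proof (rule linear_injective_0[THEN iffD2, rule_format])
    show "linear (dtmap y)"
      using linear_dtmap y by (simp add: bounded_linear.linear)
    fix v assume "dtmap y v = 0"
    then show "v = 0"
      using gmet_pos[OF y, of v] gmet_eq[OF y, of v v] by (force simp: ip_simps)
  qed
  then obtain g where g: "linear g" "g \<circ> dtmap y = id"
    using linear_injective_left_inverse linear_dtmap[OF y] bounded_linear.linear by blast
  have g': "blinfun_apply (Blinfun g) = g"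
    using g(1) by (simp add: bounded_linear_Blinfun_apply linear_conv_bounded_linear)
  have "Blinfun g o\<^sub>L D y = id_blinfun"
    by (rule blinfun_eqI) (use g(2) g' D[OF y] in \<open>simp add: o_def fun_eq_iff\<close>)
  moreover have "continuous_on E D"
    by (intro continuous_on_blinfun_componentwise)
      (use continuous_on_dtmap D in \<open>simp cong: continuous_on_cong\<close>)
  moreover have "\<And>z. z \<in> E \<Longrightarrow> (tmap has_derivative blinfun_apply (D z)) (at z)"
    using D has_derivative_tmap by simp
  ultimately obtain W W' s s' where "open W" "W \<subseteq> E" "y \<in> W" "open W'" "homeomorphism W W' tmap s"
    using inverse_function_theorem[OF open_E _ _ y, of tmap D "Blinfun g"] by metis
  then show thesis
    using that by blast
qed

end

subsection \<open>Coordinate expressions\<close>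

text \<open>Carries positive definiteness of the coordinate matrix over to the coordinate-free form
  \<open>gmet\<close>.\<close>

lemma inner_matrix_of_bilinear:
  fixes B :: "real^'n \<Rightarrow> real^'n \<Rightarrow> real"
  assumes "bilinear B"
  shows "v \<bullet> ((\<chi> i j. B (axis i 1) (axis j 1)) *v v) = B v v"
proof -
  have "B v v = B (\<Sum>i\<in>UNIV. v $ i *\<^sub>R axis i 1) (\<Sum>i\<in>UNIV. v $ i *\<^sub>R axis i 1)"
    using basis_expansion[of v] by (simp add: scalar_mult_eq_scaleR)
  also have "\<dots> = (\<Sum>(i, j)\<in>UNIV \<times> UNIV. B (v $ i *\<^sub>R axis i 1) (v $ j *\<^sub>R axis j 1))"
    by (rule bilinear_sum[OF assms])
  also have "\<dots> = (\<Sum>i\<in>UNIV. \<Sum>j\<in>UNIV. v $ i * (v $ j * B (axis i 1) (axis j 1)))"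
    using assms by (simp add: sum.cartesian_product bilinear_lmul bilinear_rmul)
  finally show ?thesis
    by (simp add: inner_vec_def matrix_vector_mult_def sum_distrib_left mult_ac)
qed

text \<open>The product rule gives the Hessian of the square of \<open>met\<close>.
  \<open>F x\<close> and \<open>met\<close> are only known to agree on \<open>E\<close>, so each
  derivative is transferred through the openness of \<open>E\<close>.\<close>

lemma finsler_tensor_eq_gmet:
  fixes ip :: "real^'n \<Rightarrow> real^'n \<Rightarrow> real"
  assumes "axial_metric ip e c E f f1 f2"
    and F: "\<And>z. z \<in> E \<Longrightarrow> F x z = axial_metric.met ip e c f z"
    and y: "y \<in> E"
  shows "finsler_tensor F x y =
    (\<chi> i j. axial_metric.gmet ip e c f f1 f2 y (axis i 1) (axis j 1))"
proof -
  interpret axial_metric ip e c E f f1 f2 by fact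
  have der: "((\<lambda>z. (F x z)\<^sup>2) has_derivative (\<lambda>v. 2 * (met z * dmet z v))) (at z)" if z: "z \<in> E" for z
  proof -
    have "((\<lambda>z. (met z)\<^sup>2) has_derivative (\<lambda>v. 2 * (met z * dmet z v))) (at z)"
      using z by (auto intro!: derivative_eq_intros has_derivative_met)
    then show ?thesis
      by (rule has_derivative_transform_within_open[OF _ open_E z]) (simp add: F)
  qed
  have p: "partial j (\<lambda>z. (F x z)\<^sup>2) z = 2 * (met z * dmet z (axis j 1))" if "z \<in> E" for z j
    unfolding partial_def using frechet_derivative_at[OF der[OF that], symmetric] by simp
  have "partial i (partial j (\<lambda>z. (F x z)\<^sup>2)) y = 2 * gmet y (axis i 1) (axis j 1)" for i j
  proof -
    let ?v = "axis j 1 :: real^'n"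
    have "((\<lambda>z. 2 * (met z * dmet z ?v)) has_derivative (\<lambda>u. 2 * gmet y u ?v)) (at y)"
      using has_derivative_mult_right[OF has_derivative_mult[OF has_derivative_met has_derivative_dmet, OF y y, of ?v], of 2]
      by (simp add: gmet_def add.commute)
    then have "(partial j (\<lambda>z. (F x z)\<^sup>2) has_derivative (\<lambda>u. 2 * gmet y u ?v)) (at y)"
      by (rule has_derivative_transform_within_open[OF _ open_E y]) (simp add: p)
    then show ?thesis
      unfolding partial_def[of i] using frechet_derivative_at by metis
  qed
  then show ?thesis
    by (simp add: finsler_tensor_def vec_eq_iff)
qed


abbreviation matrix_ip :: "real^'n^'n \<Rightarrow> real^'n \<Rightarrow> real^'n \<Rightarrow> real" where
  "matrix_ip A \<equiv> \<lambda>u v. u \<bullet> (A *v v)"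

text \<open>The dictionary between the coordinate definitions and the locale. It rests on
  \<open>e\<close> representing the 1-form divided by its norm.\<close>

lemma axial_riemannian:
  fixes a :: "real^'n \<Rightarrow> real^'n^'n"
  assumes riem: "riemannian_metric_on U a" and x: "x \<in> U"
    and c: "0 < form_norm a b x" and c1: "form_norm a b x \<le> 1"
  shows "axial (matrix_ip (a x)) (b_unit a b x) (form_norm a b x)"
    and "axial.form (matrix_ip (a x)) (b_unit a b x) (form_norm a b x) = form_val b x"
    and "axial.radius (matrix_ip (a x)) (b_unit a b x) = qt_var a b x"
    and "axial.slope (matrix_ip (a x)) (b_unit a b x) (form_norm a b x) = wt_var a b x"
    and "axial.dir (matrix_ip (a x)) (b_unit a b x) = i_vec a b x"
    and "\<And>y. (q_var a b x y)\<^sup>2 = (qt_var a b x y)\<^sup>2 + (1 / (form_norm a b x)\<^sup>2 - 1) * (form_val b x y)\<^sup>2"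
    and "\<And>y. 0 \<le> q_var a b x y"
proof -
  let ?ip = "matrix_ip (a x)" and ?e = "b_unit a b x" and ?c = "form_norm a b x"
  let ?A = "a x"
  have sym: "u \<bullet> (?A *v v) = v \<bullet> (?A *v u)" for u v
    using riem x dot_lmul_matrix[of u ?A v] transpose_matrix_vector[of ?A u]
    by (simp add: riemannian_metric_on_def inner_commute)
  have pos: "v \<noteq> 0 \<Longrightarrow> 0 < v \<bullet> (?A *v v)" for v
    using riem x by (simp add: riemannian_metric_on_def)
  have "v = 0" if "?A *v v = 0" for v
    using pos[of v] that by force
  then have "invertible ?A"
    by (metis invertible_left_inverse matrix_left_invertible_ker)
  then have "?A ** matrix_inv ?A = mat 1"
    unfolding invertible_def matrix_inv_def by (rule someI2_ex) simp
  then have up: "?A *v b_up a b x = b x"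
    by (simp add: b_up_def matrix_vector_mul_assoc)
  have c2: "?c\<^sup>2 = b x \<bullet> b_up a b x"
    using c by (simp add: form_norm_def b_up_def)
  have ip_e: "?ip ?e y = form_val b x y / ?c" for y
    by (subst sym) (simp add: b_unit_def form_val_def up matrix_vector_mult_scaleR inner_commute)
  have "bilinear ?ip"
    unfolding bilinear_def
    by (auto intro!: linearI simp: inner_add_left inner_add_right matrix_vector_right_distrib matrix_vector_mult_scaleR)
  moreover have "?ip ?e ?e = 1"
    unfolding ip_e using c c2[symmetric] by (simp add: form_val_def b_unit_def power2_eq_square)
  ultimately show ax: "axial ?ip ?e ?c"
    using sym pos c by (simp add: axial_def bilinear_conv_bounded_bilinear)
  interpret axial ?ip ?e ?c by fact
  show form: "form = form_val b x"
    using c by (simp add: fun_eq_iff form_def ip_e)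
  \<comment> \<open>Pythagoras for the transverse and the axial part of \<open>y\<close>.\<close>
  have S: "y \<bullet> (?A *v y) = (radius y)\<^sup>2 + (form y)\<^sup>2 / ?c\<^sup>2" for y
    using ip_perp_perp[of y y] c unfolding radius_sq
    by (simp add: perp_def ip_simps ip_e ip_commute[of y ?e] form power2_eq_square inner_diff_left)
  \<comment> \<open>A norm of at most 1 keeps the radicand of \<open>q_var\<close> nonnegative, so
    squaring \<open>q_var\<close> returns it.\<close>
  have "(form y)\<^sup>2 \<le> (form y)\<^sup>2 / ?c\<^sup>2" for y
    using c c1 by (simp add: le_divide_eq mult_left_le power_le_one)
  then have nn: "0 \<le> y \<bullet> (?A *v y) - (form y)\<^sup>2" for y
    unfolding S by (smt (verit) zero_le_power2)
  then show "0 \<le> q_var a b x y" for y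
    by (simp add: q_var_def form)
  from nn have q: "(q_var a b x y)\<^sup>2 = y \<bullet> (?A *v y) - (form y)\<^sup>2" for y
    using nn[of y] by (simp add: q_var_def form)
  then have "(q_var a b x y)\<^sup>2 + (1 - 1 / ?c\<^sup>2) * (form_val b x y)\<^sup>2 = (radius y)\<^sup>2" for y
    by (simp add: S form[symmetric] algebra_simps)
  then show rad: "radius = qt_var a b x"
    by (simp add: fun_eq_iff qt_var_def radius_def ip_nonneg)
  show "(q_var a b x y)\<^sup>2 = (qt_var a b x y)\<^sup>2 + (1 / ?c\<^sup>2 - 1) * (form_val b x y)\<^sup>2" for y
    unfolding q S rad[symmetric] form[symmetric] by (simp add: algebra_simps)
  show "slope = wt_var a b x"
    by (simp add: fun_eq_iff slope_def wt_var_def rad form)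
  show "dir = i_vec a b x"
  proof
    fix y
    have "perp y = y - (form_val b x y / ?c) *\<^sub>R ?e"
      by (simp add: perp_def ip_e)
    also have "\<dots> = y - (1 / ?c\<^sup>2 * form_val b x y) *\<^sub>R b_up a b x"
      by (simp add: b_unit_def power2_eq_square)
    finally show "dir y = i_vec a b x y"
      by (simp add: dir_def i_vec_def rad)
  qed
qed

text \<open>Every clause of the definition concerns one fibre at a time. The regularity clause also
  ranges over base points with empty fibre, where it is trivial and no \<open>axial_map\<close> is
  demanded.\<close>

lemma conformal_automorphismI:
  fixes a :: "real^'n \<Rightarrow> real^'n^'n"
  assumes E: "\<And>x. E x = {y. (x, y) \<in> D}"
    and am: "\<And>x. E x \<noteq> {} \<Longrightarrow>
      axial_map (matrix_ip (a x)) (e x) (c x) (E x) (f x) (f1 x) (f2 x) (X x) (Y x) (w x) (H x)"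
    and F: "\<And>x y. y \<in> E x \<Longrightarrow> F x y = axial_metric.met (matrix_ip (a x)) (e x) (c x) (f x) y"
    and t: "\<And>x y. y \<in> E x \<Longrightarrow>
      t x y = axial_map.tmap (matrix_ip (a x)) (e x) (c x) (f x) (X x) (Y x) (H x) y"
    and cone: "\<And>x y k. y \<in> E x \<Longrightarrow> 0 < k \<Longrightarrow> k *\<^sub>R y \<in> E x"
  shows "conformal_automorphism D F a H t"
  unfolding conformal_automorphism_def
proof (intro conjI allI ballI, goal_cases)
  case (1 x)
  show ?case
  proof (cases "E x = {}")
    case True
    then show ?thesis
      by (simp add: E)
  next
    case False
    interpret axial_map "matrix_ip (a x)" "e x" "c x" "E x" "f x" "f1 x" "f2 x" "X x" "Y x" "w x" "H x"
      by (rule am[OF False])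
    show ?thesis
      using Ck_on_cong[OF open_E _ Ck_on_1_tmap] t by (metis E)
  qed
next
  case (2 p)
  obtain x y where p: "p = (x, y)"
    by fastforce
  with 2 have y: "y \<in> E x"
    by (simp add: E)
  interpret axial_map "matrix_ip (a x)" "e x" "c x" "E x" "f x" "f1 x" "f2 x" "X x" "Y x" "w x" "H x"
    using am y by blast
  note m = met_pos[OF y]
  obtain W W' s where W: "open W" "y \<in> W" "W \<subseteq> E x" "open W'" "homeomorphism W W' tmap s"
    using tmap_local_homeomorphism[OF y] by blast
  then have "homeomorphism W W' (t x) s"
    using homeomorphism_cong[of W W' tmap s W W' "t x" s] t by (metis subsetD)
  then have homeo: "\<exists>W W' s. open W \<and> y \<in> W \<and> W \<subseteq> {z. (x, z) \<in> D} \<and> open W' \<and> homeomorphism W W' (t x) s"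
    using W unfolding E by blast
  have hom: "t x (k *\<^sub>R y) = (k powr H x) *\<^sub>R t x y" if "0 < k" for k
    using that m cone[OF y] y by (simp add: t tmap_def met_def form_dir_slope_scaleR mult.assoc powr_mult)
  \<comment> \<open>Since \<open>H x\<close> is positive, this power is 1 exactly when the metric
    function is 1.\<close>
  have "riem_norm a x (t x y) = met y powr H x"
    using ip_tmap[OF y] by (simp add: riem_norm_def t y)
  then have indic: "F x y = 1 \<longleftrightarrow> riem_norm a x (t x y) = 1"
    using H_pos m by (simp add: F y powr_def)
  have "(t x has_derivative dtmap y) (at y)"
    by (rule has_derivative_transform_within_open[OF has_derivative_tmap[OF y] open_E y]) (simp add: t)
  then have jac: "jacobian (t x) (at y) $ i $ j = dtmap y (axis j 1) $ i" for i j
    by (simp add: jacobian_def matrix_def frechet_derivative_at[symmetric])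
  have "finsler_tensor F x y $ i $ j =
      (1 / H x * F x y powr (1 - H x))\<^sup>2 * (dtmap y (axis i 1) \<bullet> (a x *v dtmap y (axis j 1)))" for i j
    using finsler_tensor_eq_gmet[OF axial_metric_axioms, of F x y, OF F y] gmet_eq[OF y]
    by (simp add: F y)
  then have conf: "finsler_tensor F x y $ i $ j = (1 / H x * F x y powr (1 - H x))\<^sup>2 *
      (\<Sum>k\<in>UNIV. \<Sum>l\<in>UNIV. a x $ k $ l * jacobian (t x) (at y) $ k $ i * jacobian (t x) (at y) $ l $ j)" for i j
    by (simp add: jac inner_vec_def matrix_vector_mult_def sum_distrib_left mult_ac)
  show ?case
    unfolding p using homeo hom indic conf by auto
qed


section \<open>Recognizing the given transformation as an axial map in each fibre\<close>

theorem proposition5p1: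
  fixes U :: "(real^'n) set"
    and D :: "((real^'n) \<times> (real^'n)) set"
    and a :: "real^'n \<Rightarrow> real^'n^'n"
    and b :: "real^'n \<Rightarrow> real^'n"
    and c C C1 H kb :: "real^'n \<Rightarrow> real"
    and F :: "real^'n \<Rightarrow> real^'n \<Rightarrow> real"
    and V Vt tau taut rho mu :: "real^'n \<Rightarrow> real \<Rightarrow> real"
    and t :: "real^'n \<Rightarrow> real^'n \<Rightarrow> real^'n"
  assumes dim: "CARD('n) \<ge> 3"
    and "open U"
    and riemannian: "riemannian_metric_on U a"
    and form_smooth: "smooth_on b U"
    and form_nonvanishing: "\<And>x. x \<in> U \<Longrightarrow> b x \<noteq> 0"
    and c_def: "\<And>x. c x = form_norm a b x"
    and c_bounds: "\<And>x. x \<in> U \<Longrightarrow> 0 < c x \<and> c x < 1"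
    and domain: "conic_domain_over U D"
    and domain_pos: "\<And>x y. (x, y) \<in> D \<Longrightarrow> 0 < form_val b x y \<and> 0 < qt_var a b x y"
    and finsler: "finsler_metric_on D F"
    and FS_space: "\<And>x y. (x, y) \<in> D \<Longrightarrow> F x y = form_val b x y * V x (w_var a b x y)"
    and Vt_def: "Vt = in_wt c V"
    and tau_def: "tau = tau_of V"
    and taut_def: "taut = tau_of Vt"
    and C_bounds: "\<And>x. x \<in> U \<Longrightarrow> C x > 0 \<and> C x > \<bar>C1 x\<bar>"
    and H_def: "\<And>x. H x = sqrt ((C x)\<^sup>2 - (C1 x)\<^sup>2)"
    and kb_def: "\<And>x. kb x = sqrt ((C x - C1 x) / (C x + C1 x))"
    and sqrt_mu: "\<And>x y w. (x, y) \<in> D \<Longrightarrow> w = w_var a b x y \<Longrightarrow>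
          sqrt (mu x w) = C x + C1 x * cos (rho x w)"
    and mu_eq: "\<And>x y w wt. (x, y) \<in> D \<Longrightarrow> w = w_var a b x y \<Longrightarrow> wt = wt_var a b x y \<Longrightarrow>
          mu x w = tau x w / wt\<^sup>2 * (sin (rho x w))\<^sup>2"
    and rho_eq: "\<And>x y wt. (x, y) \<in> D \<Longrightarrow> wt = wt_var a b x y \<Longrightarrow>
          (in_wt c rho x has_real_derivative
             1 / wt * sqrt ((taut x wt - wt * (deriv (taut x) wt - wt)) / taut x wt)
               * sin (in_wt c rho x wt)) (at wt)"
    and t_def: "\<And>x y w. (x, y) \<in> D \<Longrightarrow> w = w_var a b x y \<Longrightarrow>
          t x y = (H x / sqrt (mu x w) * F x y powr H x) *\<^sub>R
            (sin (rho x w) *\<^sub>R i_vec a b x y +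
             (1 / (2 * kb x) * (1 - (kb x)\<^sup>2 + (1 + (kb x)\<^sup>2) * cos (rho x w))) *\<^sub>R b_unit a b x)"
  shows "conformal_automorphism D F a H t"
proof (rule conformal_automorphismI)
  \<comment> \<open>All profiles are functions of \<open>s\<close>, the value of w tilde.
    \<open>M\<close> is the root of mu, expressed through rho so that it is defined and positive for
    every \<open>s\<close>; \<open>R'\<close> carries the radicand in its simplified form.\<close>
  define R where "R = in_wt c rho"
  define M where "M x s = C x + C1 x * cos (R x s)" for x s
  define f1 where "f1 x = deriv (Vt x)" for x
  define f2 where "f2 x = deriv (f1 x)" for x
  define X where "X x s = H x * sin (R x s) / M x s" for x s
  define Y where "Y x s = (C1 x + C x * cos (R x s)) / M x s" for x s
  define R' where "R' x s = 1 / s * sqrt (s * f2 x s / f1 x s) * sin (R x s)" for x s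
  define w where "w x s = H x * R' x s / M x s" for x s
  define E where "E x = {y. (x, y) \<in> D}" for x
  show "E x = {y. (x, y) \<in> D}" for x
    by (fact E_def)
  show "k *\<^sub>R y \<in> E x" if "y \<in> E x" "0 < k" for x y k
    using domain that by (simp add: E_def conic_domain_over_def)
  have open_D: "open D" and U: "\<And>x y. y \<in> E x \<Longrightarrow> x \<in> U"
    using domain by (auto simp: conic_domain_over_def E_def)
  have D2: "Ck_on 2 (\<lambda>(x, y). F x y) D"
    using finsler by (auto simp: finsler_metric_on_def smooth_on_def)
  have cn: "0 < form_norm a b x" "form_norm a b x \<le> 1" "form_norm a b x = c x" if "y \<in> E x" for x y
    using c_bounds[OF U[OF that]] by (simp_all add: c_def)
  have ax: "axial (matrix_ip (a x)) (b_unit a b x) (c x)"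
    "axial.form (matrix_ip (a x)) (b_unit a b x) (c x) = form_val b x"
    "axial.radius (matrix_ip (a x)) (b_unit a b x) = qt_var a b x"
    "axial.slope (matrix_ip (a x)) (b_unit a b x) (c x) = wt_var a b x"
    "axial.dir (matrix_ip (a x)) (b_unit a b x) = i_vec a b x"
    "(q_var a b x y)\<^sup>2 = (qt_var a b x y)\<^sup>2 + (1 / (c x)\<^sup>2 - 1) * (form_val b x y)\<^sup>2"
    "0 \<le> q_var a b x y"
    if "y \<in> E x" for x y
    using axial_riemannian[OF riemannian U[OF that] cn(1,2)[OF that]] unfolding cn(3)[OF that] by auto
  have pos: "0 < form_val b x y" "0 < qt_var a b x y" "0 < wt_var a b x y" if "y \<in> E x" for x y
    using domain_pos[of x y] that by (auto simp: E_def wt_var_def)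
  \<comment> \<open>The squares of w and w tilde differ by a constant at fixed \<open>x\<close>.
    Positivity of w ensures that the root inside \<open>in_wt\<close> returns w itself.\<close>
  have w_pos: "0 < w_var a b x y"
    and w_sq: "(w_var a b x y)\<^sup>2 = (wt_var a b x y)\<^sup>2 - 1 + 1 / (c x)\<^sup>2"
    and w_wt: "w_var a b x y = sqrt ((wt_var a b x y)\<^sup>2 - 1 + 1 / (c x)\<^sup>2)"
    if y: "y \<in> E x" for x y
  proof -
    have c1: "0 \<le> 1 / (c x)\<^sup>2 - 1"
      using c_bounds[OF U[OF y]] by (simp add: le_divide_eq power_le_one)
    have "0 < (q_var a b x y)\<^sup>2"
      unfolding ax(6)[OF y] using pos[OF y] c1 by (intro add_pos_nonneg) auto
    then have "q_var a b x y \<noteq> 0"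
      by auto
    then show wp: "0 < w_var a b x y"
      using pos[OF y] ax(7)[OF y] by (simp add: w_var_def)
    show "(w_var a b x y)\<^sup>2 = (wt_var a b x y)\<^sup>2 - 1 + 1 / (c x)\<^sup>2"
      using pos[OF y] by (simp add: w_var_def wt_var_def power_divide ax(6)[OF y] field_simps)
    then show "w_var a b x y = sqrt ((wt_var a b x y)\<^sup>2 - 1 + 1 / (c x)\<^sup>2)"
      using wp by (metis abs_of_pos real_sqrt_abs)
  qed
  have in_wt: "in_wt c h x (wt_var a b x y) = h x (w_var a b x y)" if "y \<in> E x" for h :: "real^'n \<Rightarrow> real \<Rightarrow> real" and x y
    by (simp add: in_wt_def w_wt[OF that])
  have F: "F x y = form_val b x y * Vt x (wt_var a b x y)" if "y \<in> E x" for x y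
    using FS_space[of x y] that in_wt[OF that, of V] by (simp add: Vt_def E_def)
  have F_pos: "0 < F x y" and f_pos: "0 < Vt x (wt_var a b x y)" if "y \<in> E x" for x y
  proof -
    show "0 < F x y"
      using finsler that by (auto simp: finsler_metric_on_def E_def)
    then show "0 < Vt x (wt_var a b x y)"
      using F[OF that] pos(1)[OF that] by (simp add: zero_less_mult_iff)
  qed
  \<comment> \<open>The profile \<open>V\<close> carries no smoothness hypothesis; its
    differentiability is extracted from that of \<open>F\<close>.\<close>
  have der: "(Vt x has_real_derivative f1 x (wt_var a b x y)) (at (wt_var a b x y))"
    "(f1 x has_real_derivative f2 x (wt_var a b x y)) (at (wt_var a b x y))"
    "isCont (f2 x) (wt_var a b x y)" if y: "y \<in> E x" for x y
    using axial.slope_profile_derivs[OF ax(1)[OF y] open_D D2, of x "Vt x" y] y pos F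
    unfolding ax(2-4)[OF y] f1_def f2_def by (simp_all add: E_def)
  have am: "axial_metric (matrix_ip (a x)) (b_unit a b x) (c x) (E x) (Vt x) (f1 x) (f2 x)" if y: "y \<in> E x" for x y
  proof -
    have "open (E x)"
      using open_vimage[OF open_D, of "Pair x"] by (simp add: E_def vimage_def continuous_intros)
    then show ?thesis
      unfolding axial_metric_def axial_metric_axioms_def ax(2-4)[OF y]
      using ax(1)[OF y] pos der by blast
  qed
  have met: "F x z = axial_metric.met (matrix_ip (a x)) (b_unit a b x) (c x) (Vt x) z" if z: "z \<in> E x" for x z
    unfolding axial_metric.met_def[OF am[OF z]] ax(2-4)[OF z] by (rule F[OF z])
  then show "\<And>x y. y \<in> E x \<Longrightarrow> F x y = axial_metric.met (matrix_ip (a x)) (b_unit a b x) (c x) (Vt x) y" .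
  have gmet_pos: "0 < axial_metric.gmet (matrix_ip (a x)) (b_unit a b x) (c x) (Vt x) (f1 x) (f2 x) y v v"
    if y: "y \<in> E x" and v: "v \<noteq> 0" for x y v
  proof -
    have "0 < v \<bullet> (finsler_tensor F x y *v v)"
      using finsler y v by (auto simp: finsler_metric_on_def E_def)
    then show ?thesis
      using finsler_tensor_eq_gmet[OF am[OF y], of F x y, OF met y]
        inner_matrix_of_bilinear[OF axial_metric.bilinear_gmet[OF am[OF y]], of v y]
      by simp
  qed
  \<comment> \<open>If \<open>\<theta>\<close> is the angle between the image and the axis, then \<open>tan (\<theta>/2) = kb tan (\<rho>/2)\<close>; hence
      \<open>sin \<theta> = H sin \<rho> / M\<close>, \<open>cos \<theta> = (C1 + C cos \<rho>) / M\<close> and \<open>d\<theta>/d\<rho> = H / M\<close>.\<close>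
  have M_pos: "0 < M x s" if "x \<in> U" for x s
  proof -
    have "\<bar>C1 x * cos (R x s)\<bar> \<le> \<bar>C1 x\<bar>"
      by (simp add: abs_mult mult_left_le)
    then show ?thesis
      using C_bounds[OF that] unfolding M_def by linarith
  qed
  have H: "0 < H x" "(H x)\<^sup>2 = (C x)\<^sup>2 - (C1 x)\<^sup>2" if "x \<in> U" for x
  proof -
    have "(C1 x)\<^sup>2 < (C x)\<^sup>2"
      using C_bounds[OF that] by (metis abs_le_square_iff abs_of_pos not_le)
    then show "0 < H x" "(H x)\<^sup>2 = (C x)\<^sup>2 - (C1 x)\<^sup>2"
      by (simp_all add: H_def)
  qed
  have taut: "taut x s = s * Vt x s / f1 x s" for x s
    by (simp add: taut_def tau_of_def f1_def)
  \<comment> \<open>At fixed \<open>x\<close>, w dw equals the same product for w tilde, so the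
    quotient of the variable by the derivative of the profile is the same in both variables.\<close>
  have tau: "tau x (w_var a b x y) = taut x (wt_var a b x y)" if y: "y \<in> E x" for x y
  proof -
    let ?s = "wt_var a b x y" and ?w = "w_var a b x y"
    let ?g = "\<lambda>v. sqrt (v\<^sup>2 + 1 - 1 / (c x)\<^sup>2)"
    have wsq: "?w\<^sup>2 + 1 - 1 / (c x)\<^sup>2 = ?s\<^sup>2"
      by (simp add: w_sq[OF y])
    then have gw: "?g ?w = ?s" and arg_pos: "0 < ?w\<^sup>2 + 1 - 1 / (c x)\<^sup>2"
      using pos(3)[OF y] by simp_all
    have "(?g has_real_derivative ?w / ?s) (at ?w)"
      using wsq pos(3)[OF y] by (auto intro!: derivative_eq_intros simp: field_simps)
    then have "((\<lambda>v. Vt x (?g v)) has_real_derivative f1 x ?s * (?w / ?s)) (at ?w)"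
      using DERIV_chain2[of "Vt x" _ ?g] der(1)[OF y] gw by metis
    \<comment> \<open>\<open>V x\<close> is \<open>Vt x\<close> after \<open>?g\<close> where the
      argument is positive and the radicand is positive; the derivative needs this on an open
      set.\<close>
    moreover have "open ({0<..} \<inter> {v. 0 < v\<^sup>2 + 1 - 1 / (c x)\<^sup>2})"
      by (intro open_Int open_greaterThan open_Collect_less continuous_intros)
    ultimately have "(V x has_real_derivative f1 x ?s * (?w / ?s)) (at ?w)"
      by (rule has_field_derivative_transform_within_open)
        (use w_pos[OF y] arg_pos in \<open>auto simp: Vt_def in_wt_def\<close>)
    then have "deriv (V x) ?w = f1 x ?s * (?w / ?s)"
      by (rule DERIV_imp_deriv)
    then show ?thesis
      using w_pos[OF y] pos(3)[OF y] in_wt[OF y, of V] by (simp add: tau_def tau_of_def taut Vt_def)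
  qed
  \<comment> \<open>Cleared of denominators, the formula for mu becomes the transverse condition
    \<open>X_sq\<close>; its left side is nonnegative, which fixes the sign of
    \<open>f1\<close>.\<close>
  have f1_eq: "Vt x s * (sin (R x s))\<^sup>2 = s * f1 x s * (M x s)\<^sup>2"
    and f1_pos: "0 < f1 x s"
    and mu: "sqrt (mu x (w_var a b x y)) = M x s"
    if y: "y \<in> E x" and s: "s = wt_var a b x y" for x y s
  proof -
    have D: "(x, y) \<in> D"
      using y by (simp add: E_def)
    note Mp = M_pos[OF U[OF y], of s]
    show mu: "sqrt (mu x (w_var a b x y)) = M x s"
      using sqrt_mu[OF D refl] in_wt[OF y, of rho] by (simp add: M_def R_def s)
    \<comment> \<open>\<open>sqrt\<close> of a negative number is negative here, so a positive root
      first forces mu to be positive.\<close>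
    then have "(M x s)\<^sup>2 = mu x (w_var a b x y)"
      using Mp by (metis less_eq_real_def real_sqrt_gt_0_iff real_sqrt_pow2)
    also have "\<dots> = Vt x s / (s * f1 x s) * (sin (R x s))\<^sup>2"
      using mu_eq[OF D refl refl] tau[OF y] in_wt[OF y, of rho] pos(3)[OF y]
      by (simp add: taut s R_def power2_eq_square)
    \<comment> \<open>A vanishing derivative of \<^term>\<open>V x\<close> would give \<open>tau = 0\<close> by division by zero, and then \<open>mu = 0\<close>.\<close>
    finally have M2: "(M x s)\<^sup>2 = Vt x s / (s * f1 x s) * (sin (R x s))\<^sup>2" .
    then have nz: "f1 x s \<noteq> 0"
      using Mp by auto
    then show eq: "Vt x s * (sin (R x s))\<^sup>2 = s * f1 x s * (M x s)\<^sup>2"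
      using pos(3)[OF y] M2 by (simp add: s)
    have "0 \<le> f1 x s * (s * (M x s)\<^sup>2)"
      using f_pos[OF y] eq by (metis mult.assoc mult.commute mult_nonneg_nonneg less_imp_le s zero_le_power2)
    moreover have "0 < s * (M x s)\<^sup>2"
      using Mp pos(3)[OF y] by (simp add: s)
    ultimately show "0 < f1 x s"
      using nz by (metis less_eq_real_def zero_le_mult_iff not_le)
  qed
  \<comment> \<open>The radicand in the equation for \<^term>\<open>rho\<close> is \<^term>\<open>\<lambda>s. s * f2 x s / f1 x s\<close>, so its sign matters.\<close>
  have f2_pos: "0 < f2 x (wt_var a b x y)" if y: "y \<in> E x" for x y
    using axial_metric.f2_pos[OF am[OF y] y] F_pos[OF y] gmet_pos[OF y] f1_pos[OF y refl]
    unfolding met[OF y, symmetric] ax(4)[OF y] by simp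
  have R: "(R x has_real_derivative R' x s) (at s)" if y: "y \<in> E x" and s: "s = wt_var a b x y" for x y s
  proof -
    have D: "(x, y) \<in> D"
      using y by (simp add: E_def)
    note nz = f1_pos[OF y s] f_pos[OF y, folded s] pos(3)[OF y, folded s]
    note d = der(1,2)[OF y, folded s]
    \<comment> \<open>In \<open>taut x s - s * (deriv (taut x) s - s)\<close> every term without
      \<open>f2\<close> will cancel.\<close>
    have "((\<lambda>s. s * Vt x s / f1 x s) has_real_derivative
        ((Vt x s + s * f1 x s) * f1 x s - s * Vt x s * f2 x s) / (f1 x s)\<^sup>2) (at s)"
      using nz by (auto intro!: derivative_eq_intros d simp: field_simps power2_eq_square)
    then have "deriv (taut x) s = ((Vt x s + s * f1 x s) * f1 x s - s * Vt x s * f2 x s) / (f1 x s)\<^sup>2"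
      unfolding taut[abs_def] by (rule DERIV_imp_deriv)
    then have "deriv (taut x) s - s = Vt x s / f1 x s - s * Vt x s * f2 x s / (f1 x s)\<^sup>2"
      using nz by (simp add: field_simps power2_eq_square)
    then have "taut x s - s * (deriv (taut x) s - s) = s * (s * Vt x s * f2 x s / (f1 x s)\<^sup>2)"
      by (simp add: taut right_diff_distrib)
    then have "(taut x s - s * (deriv (taut x) s - s)) / taut x s = s * f2 x s / f1 x s"
      using nz by (simp add: taut power2_eq_square)
    then show ?thesis
      using rho_eq[OF D s] by (simp add: R'_def R_def)
  qed
  show am2: "axial_map (matrix_ip (a x)) (b_unit a b x) (c x) (E x) (Vt x) (f1 x) (f2 x) (X x) (Y x) (w x) (H x)"
    if ne: "E x \<noteq> {}" for x
  proof -
    \<comment> \<open>Any point of the fibre puts \<open>x\<close> into \<open>U\<close> and makes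
      the dictionary available at \<open>x\<close>.\<close>
    obtain y0 where y0: "y0 \<in> E x"
      using ne by blast
    note u = U[OF y0]
    show ?thesis
      unfolding axial_map_def axial_map_axioms_def ax(2-4)[OF y0]
    proof (intro conjI allI impI am[OF y0] H(1)[OF u])
      fix y assume y: "y \<in> E x"
      define s where "s = wt_var a b x y"
      note mp = M_pos[OF u, of s] and dR = R[OF y s_def] and Hx = H[OF u]
      note sp = pos(3)[OF y, folded s_def] and fp = f_pos[OF y, folded s_def]
      note f1p = f1_pos[OF y s_def] and f2p = f2_pos[OF y, folded s_def] and f1e = f1_eq[OF y s_def]
      show "0 < axial_metric.met (matrix_ip (a x)) (b_unit a b x) (c x) (Vt x) y"
        using met[OF y] F_pos[OF y] by simp
      have dM: "(M x has_real_derivative - C1 x * sin (R x s) * R' x s) (at s)"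
        unfolding M_def by (auto intro!: derivative_eq_intros dR)
      show "isCont (w x) (wt_var a b x y)"
        unfolding s_def[symmetric] w_def R'_def using sp f1p mp
        by (intro continuous_intros DERIV_isCont[OF dR] DERIV_isCont[OF dM]
            DERIV_isCont[OF der(2)[OF y, folded s_def]] der(3)[OF y, folded s_def] isCont_sin) auto
      have "(X x has_real_derivative
          (H x * (cos (R x s) * R' x s) * M x s - H x * sin (R x s) * (- C1 x * sin (R x s) * R' x s)) / (M x s * M x s)) (at s)"
        unfolding X_def using mp by (auto intro!: derivative_eq_intros dR dM)
      \<comment> \<open>The sum of squares is left visible so that it collapses to 1, giving the
        numerator of \<open>Y\<close> times that of \<open>w\<close>.\<close>
      moreover have "H x * (cos (R x s) * R' x s) * M x s - H x * sin (R x s) * (- C1 x * sin (R x s) * R' x s)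
          = H x * R' x s * (C x * cos (R x s) + C1 x * ((cos (R x s))\<^sup>2 + (sin (R x s))\<^sup>2))"
        unfolding M_def by algebra
      ultimately show "(X x has_real_derivative Y x (wt_var a b x y) * w x (wt_var a b x y)) (at (wt_var a b x y))"
        using mp unfolding s_def[symmetric] by (simp add: Y_def w_def add.commute mult.commute)
      have "(Y x has_real_derivative
          (- C x * (sin (R x s) * R' x s) * M x s - (C1 x + C x * cos (R x s)) * (- C1 x * sin (R x s) * R' x s)) / (M x s * M x s)) (at s)"
        unfolding Y_def using mp by (auto intro!: derivative_eq_intros dR dM)
      \<comment> \<open>The mixed terms \<open>C x * C1 x\<close> cancel and the rest is a multiple
        of the square of \<open>H x\<close>.\<close>
      moreover have "- C x * (sin (R x s) * R' x s) * M x s - (C1 x + C x * cos (R x s)) * (- C1 x * sin (R x s) * R' x s)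
          = - (H x * sin (R x s)) * (H x * R' x s)"
      proof -
        have "- (H x * sin (R x s)) * (H x * R' x s) = - ((H x)\<^sup>2 * sin (R x s) * R' x s)"
          by (simp add: power2_eq_square)
        then show ?thesis
          unfolding Hx(2) by (simp add: M_def algebra_simps power2_eq_square)
      qed
      ultimately show "(Y x has_real_derivative - X x (wt_var a b x y) * w x (wt_var a b x y)) (at (wt_var a b x y))"
        unfolding s_def[symmetric] by (simp add: X_def w_def)
      have "(H x)\<^sup>2 * (sin (R x s))\<^sup>2 + (C1 x + C x * cos (R x s))\<^sup>2 = (M x s)\<^sup>2"
        unfolding Hx(2) sin_squared_eq by (simp add: M_def algebra_simps power2_eq_square)
      then show "(X x (wt_var a b x y))\<^sup>2 + (Y x (wt_var a b x y))\<^sup>2 = 1"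
        using mp unfolding s_def[symmetric]
        by (simp add: X_def Y_def power_divide power_mult_distrib add_divide_distrib[symmetric])
      have "(X x s)\<^sup>2 * Vt x s = (H x)\<^sup>2 * (Vt x s * (sin (R x s))\<^sup>2) / (M x s)\<^sup>2"
        by (simp add: X_def power_divide power_mult_distrib)
      then show "(X x (wt_var a b x y))\<^sup>2 * Vt x (wt_var a b x y) =
          (H x)\<^sup>2 * wt_var a b x y * f1 x (wt_var a b x y)"
        using mp unfolding f1e s_def[symmetric] by simp
      have "0 \<le> s * f2 x s / f1 x s"
        using sp f1p f2p by simp
      then have "(R' x s)\<^sup>2 = 1 / s\<^sup>2 * (s * f2 x s / f1 x s) * (sin (R x s))\<^sup>2"
        by (simp add: R'_def power_mult_distrib power_divide)
      moreover have "(w x s)\<^sup>2 * Vt x s = (H x)\<^sup>2 * (R' x s)\<^sup>2 * Vt x s / (M x s)\<^sup>2"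
        by (simp add: w_def power_divide power_mult_distrib)
      \<comment> \<open>The grouping exposes the left side of \<open>f1_eq\<close>; replacing it
        cancels everything except \<open>f2\<close>.\<close>
      ultimately have "(w x s)\<^sup>2 * Vt x s = (H x)\<^sup>2 * f2 x s / (s * f1 x s) * (Vt x s * (sin (R x s))\<^sup>2) / (M x s)\<^sup>2"
        using sp by (simp add: power2_eq_square)
      then show "(w x (wt_var a b x y))\<^sup>2 * Vt x (wt_var a b x y) = (H x)\<^sup>2 * f2 x (wt_var a b x y)"
        using mp sp f1p unfolding f1e s_def[symmetric] by simp
    next
      fix y and v :: "real^'n" assume "y \<in> E x" "v \<noteq> 0"
      then show "0 < axial_metric.gmet (matrix_ip (a x)) (b_unit a b x) (c x) (Vt x) (f1 x) (f2 x) y v v"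
        by (rule gmet_pos)
    qed
  qed
  show "t x y = axial_map.tmap (matrix_ip (a x)) (b_unit a b x) (c x) (Vt x) (X x) (Y x) (H x) y"
    if y: "y \<in> E x" for x y
  proof -
    define s where "s = wt_var a b x y"
    note u = U[OF y] and mp = M_pos[OF U[OF y], of s]
    have "E x \<noteq> {}"
      using y by blast
    note ax_map = am2[OF this]
    have D: "(x, y) \<in> D"
      using y by (simp add: E_def)
    have r: "rho x (w_var a b x y) = R x s"
      using in_wt[OF y, of rho] by (simp add: R_def s_def)
    have CC: "0 < C x + C1 x" "0 < C x - C1 x"
      using C_bounds[OF u] by auto
    have kb2: "(kb x)\<^sup>2 = (C x - C1 x) / (C x + C1 x)"
      using CC by (simp add: kb_def)
    \<comment> \<open>The square of \<open>H x\<close> factors as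
      \<open>(C x - C1 x) * (C x + C1 x)\<close>, which removes the root from
      \<open>kb\<close>.\<close>
    have "(H x / (C x + C1 x))\<^sup>2 = (C x - C1 x) / (C x + C1 x)"
      using CC unfolding power_divide H(2)[OF u]
      by (simp add: square_diff_square_factored power2_eq_square)
    then have kb: "kb x = H x / (C x + C1 x)"
      unfolding kb_def using CC H(1)[OF u] by (intro real_sqrt_unique) auto
    \<comment> \<open>Prepares the axial coefficient of \<open>t\<close>, which becomes the
      numerator of \<open>Y\<close> over \<open>H x\<close>; the prefactor
      \<open>H x / M x s\<close> then turns it into \<open>Y\<close>.\<close>
    have cancel: "1 / (2 * kb x) * (2 * N / (C x + C1 x)) = N / H x" for N
      using CC H(1)[OF u] by (simp add: kb)
    have "1 - (kb x)\<^sup>2 = 2 * C1 x / (C x + C1 x)" "1 + (kb x)\<^sup>2 = 2 * C x / (C x + C1 x)"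
      unfolding kb2 using CC by (simp_all add: field_simps)
    then have "1 - (kb x)\<^sup>2 + (1 + (kb x)\<^sup>2) * cos (R x s) = 2 * (C1 x + C x * cos (R x s)) / (C x + C1 x)"
      by (simp add: add_divide_distrib distrib_left)
    then have "1 / (2 * kb x) * (1 - (kb x)\<^sup>2 + (1 + (kb x)\<^sup>2) * cos (R x s)) = (C1 x + C x * cos (R x s)) / H x"
      by (simp only: cancel)
    then have "t x y = (H x / M x s * F x y powr H x) *\<^sub>R
        (sin (R x s) *\<^sub>R i_vec a b x y + ((C1 x + C x * cos (R x s)) / H x) *\<^sub>R b_unit a b x)"
      unfolding t_def[OF D refl] mu[OF y s_def] r by simp
    also have "\<dots> = (F x y powr H x) *\<^sub>R (X x s *\<^sub>R i_vec a b x y + Y x s *\<^sub>R b_unit a b x)"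
      using H(1)[OF u] by (simp add: X_def Y_def scaleR_add_right)
    finally show ?thesis
      unfolding axial_map.tmap_def[OF ax_map] met[OF y, symmetric] ax(4,5)[OF y] s_def .
  qed
qed

end
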